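(* Let $r\ge 2$, $m\ge 1$, $k\ge 1$ be integers, and let $q,s,l$ be the integers determined by $$k-1=(r-1)q+s,\quad 0\le s<r-1,\qquad m=qr+s+1+l .$$ Let $T_{m,k,r}$ be the set of all $r$-uniform hypertrees with $m$ edges that have a $k$-matching, and let $A(m,k,r)$ be the hypertree $S((r-1)^{(q)},s,0^{(l)})$ defined in the context. Then for every $\mathcal{T}\in T_{m,k,r}$, $$\rho(\mathcal{T})\le\left(\frac{1}{1-\alpha_0}\right)^{1/r},$$ where $\alpha_0$ is the maximum (real) root of the equation $$x^{r-1}\left(\frac{1}{1-x}-\frac{1}{x^{s}}-l\right)=q .$$ Furthermore, equality holds if and only if $\mathcal{T}=A(m,k,r)$ (up to isomorphism).
   Context: A hypergraph $\mathcal{H}=(V,E)$ is a finite vertex set $V$ together with a finite family $E$ of subsets of $V$ called edges. It is $r$-uniform if every edge has exactly $r$ vertices. All hypergraphs are assumed linear (any two edges share at most one vertex) and $r$-uniform. A walk is an alternating sequence $v_1e_1v_2e_2\cdots v_\ell e_\ell v_{\ell+1}$ with $v_i,v_{i+1}\in e_i$ for all $i$; it is a path if all its vertices and edges are distinct; a cycle is a closed walk ($v_{\ell+1}=v_1$) with $\ell\ge 2$ in which $v_1,\dots,v_\ell$ are distinct and $e_1,\dots,e_\ell$ are distinct. A hypergraph is connected if any two vertices are joined by a path. A hypertree is a connected hypergraph containing no cycle. A $k$-matching is a set of $k$ pairwise disjoint edges. Spectral radius: for an $r$-uniform hypergraph $\mathcal{H}$ on vertex set $[n]=\{1,\dots,n\}$,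 the adjacency tensor is $\mathcal{A}(\mathcal{H})=(a_{i_1\cdots i_r})$, of order $r$ and dimension $n$, with $a_{i_1\cdots i_r}=\frac{1}{(r-1)!}$ if $\{i_1,\dots,i_r\}\in E$ and $0$ otherwise. A number $\lambda\in\mathbb{C}$ is an eigenvalue of $\mathcal{A}$ if there is a nonzero $x\in\mathbb{C}^n$ with $\sum_{i_2,\dots,i_r=1}^n a_{ii_2\cdots i_r}x_{i_2}\cdots x_{i_r}=\lambda x_i^{r-1}$ for all $i\in[n]$. The spectral radius $\rho(\mathcal{H})$ is the maximum modulus of the eigenvalues of $\mathcal{A}(\mathcal{H})$. The hypertrees $S(a_1,\dots,a_t)$: the hyperstar $S_t^r$ is the $r$-uniform hypergraph with $t$ edges $e_1,\dots,e_t$ all containing a common vertex $v$ (the center), where the sets $e_i\setminus\{v\}$ are pairwise disjoint, and with no other vertices. A core vertex is a vertex of degree one (contained in exactly one edge). A pendent edge is an edge containing exactly $r-1$ core vertices. For integers $0\le a_i\le r-1$, $S(a_1,\dots,a_t)$ is obtained from $S_t^r$ by attaching, for each $i$, $a_i$ disjoint pendent edges at $a_i$ distinct vertices of $e_i\setminus\{v\}$, one at each (each attached edge consists of the chosen vertex and $r-1$ new vertices). The exponent notation $a^{(p)}$ means that the entry $a$ is repeated $p$ times; thus $S((r-1)^{(q)},s,0^{(l)})$ (formed for $l\ge 0$) is built on a hyperstar with $q+1+l$ edges, of which $q$ have parameter $r-1$, one has parameter $s$ and $l$ have parameter $0$. *)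

theory Defs
  imports Complex_Main
begin

type_synonym 'a hypergraph = "'a set \<times> 'a set set"

abbreviation verts :: "'a hypergraph \<Rightarrow> 'a set" where
  "verts H \<equiv> fst H"

abbreviation edges :: "'a hypergraph \<Rightarrow> 'a set set" where
  "edges H \<equiv> snd H"

definition hypergraph :: "'a hypergraph \<Rightarrow> bool" where
  "hypergraph H \<longleftrightarrow> finite (verts H) \<and> edges H \<subseteq> Pow (verts H)"

definition uniform :: "nat \<Rightarrow> 'a hypergraph \<Rightarrow> bool" where
  "uniform r H \<longleftrightarrow> (\<forall>e\<in>edges H. card e = r)"

definition linear_hypergraph :: "'a hypergraph \<Rightarrow> bool" where
  "linear_hypergraph H \<longleftrightarrow> (\<forall>e\<in>edges H. \<forall>f\<in>edges H. e \<noteq> f \<longrightarrow> card (e \<inter> f) \<le> 1)"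

text \<open>
  An alternating sequence is represented by its list of vertices and its list of edges.
  The one-vertex walk (no edges) is allowed, so that every vertex is joined to itself.
\<close>

definition walk :: "'a hypergraph \<Rightarrow> 'a list \<Rightarrow> 'a set list \<Rightarrow> bool" where
  "walk H vs es \<longleftrightarrow> length vs = length es + 1 \<and> set vs \<subseteq> verts H \<and> set es \<subseteq> edges H \<and>
     (\<forall>i<length es. vs ! i \<in> es ! i \<and> vs ! (i + 1) \<in> es ! i)"

definition path :: "'a hypergraph \<Rightarrow> 'a list \<Rightarrow> 'a set list \<Rightarrow> bool" where
  "path H vs es \<longleftrightarrow> walk H vs es \<and> distinct vs \<and> distinct es"

definition cycle :: "'a hypergraph \<Rightarrow> 'a list \<Rightarrow> 'a set list \<Rightarrow> bool" where
  "cycle H vs es \<longleftrightarrow> walk H vs es \<and> last vs = hd vs \<and> length es \<ge> 2 \<and>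
     distinct (butlast vs) \<and> distinct es"

definition connected_hypergraph :: "'a hypergraph \<Rightarrow> bool" where
  "connected_hypergraph H \<longleftrightarrow>
     (\<forall>u\<in>verts H. \<forall>v\<in>verts H. \<exists>vs es. path H vs es \<and> hd vs = u \<and> last vs = v)"

definition hypertree :: "'a hypergraph \<Rightarrow> bool" where
  "hypertree H \<longleftrightarrow> connected_hypergraph H \<and> (\<nexists>vs es. cycle H vs es)"

definition has_matching :: "nat \<Rightarrow> 'a hypergraph \<Rightarrow> bool" where
  "has_matching k H \<longleftrightarrow> (\<exists>M\<subseteq>edges H. finite M \<and> card M = k \<and> pairwise disjnt M)"

definition hypertrees_with_matching :: "nat \<Rightarrow> nat \<Rightarrow> nat \<Rightarrow> 'a hypergraph set" where
  "hypertrees_with_matching m k r =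
     {H. hypergraph H \<and> uniform r H \<and> linear_hypergraph H \<and> hypertree H \<and>
         card (edges H) = m \<and> has_matching k H}"

definition hypergraph_iso :: "'a hypergraph \<Rightarrow> 'b hypergraph \<Rightarrow> bool" where
  "hypergraph_iso G H \<longleftrightarrow>
     (\<exists>f. bij_betw f (verts G) (verts H) \<and> (\<lambda>e. f ` e) ` edges G = edges H)"

text \<open>
  Tensors of order \<open>r\<close> are indexed by lists of length \<open>r\<close> over an arbitrary finite index set \<open>V\<close>
  instead of over \<open>{1..n}\<close>; no numbering of the vertices has to be chosen.
\<close>

definition adjacency_tensor :: "nat \<Rightarrow> 'a hypergraph \<Rightarrow> 'a list \<Rightarrow> complex" where
  "adjacency_tensor r H is = (if set is \<in> edges H then 1 / fact (r - 1) else 0)"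

definition tensor_eigenvalue :: "nat \<Rightarrow> 'a set \<Rightarrow> ('a list \<Rightarrow> complex) \<Rightarrow> complex \<Rightarrow> bool" where
  "tensor_eigenvalue r V a c \<longleftrightarrow>
     (\<exists>x. (\<exists>i\<in>V. x i \<noteq> 0) \<and>
       (\<forall>i\<in>V. (\<Sum>js | length js = r - 1 \<and> set js \<subseteq> V. a (i # js) * prod_list (map x js))
              = c * x i ^ (r - 1)))"

definition spectral_radius :: "nat \<Rightarrow> 'a hypergraph \<Rightarrow> real" where
  "spectral_radius r H =
     (GREATEST \<rho>. \<exists>c. tensor_eigenvalue r (verts H) (adjacency_tensor r H) c \<and> \<rho> = cmod c)"

text \<open>
  Vertices of the hypertree \<open>S(a\<^sub>0, \<dots>, a\<^sub>t\<^sub>-\<^sub>1)\<close> (indices start at 0):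
  \<open>Star_Vertex i j\<close> is the \<open>j\<close>-th noncentral vertex of the \<open>i\<close>-th star edge, and
  \<open>Pendent_Vertex i j p\<close> is the \<open>p\<close>-th new vertex of the pendent edge attached at
  \<open>Star_Vertex i j\<close>. Up to isomorphism it is irrelevant at which \<open>a\<^sub>i\<close> noncentral
  vertices of the \<open>i\<close>-th star edge the pendent edges are attached; the first \<open>a\<^sub>i\<close> are used.
\<close>

datatype S_vertex = Center | Star_Vertex nat nat | Pendent_Vertex nat nat nat

definition star_edge :: "nat \<Rightarrow> nat \<Rightarrow> S_vertex set" where
  "star_edge r i = insert Center {Star_Vertex i j | j. j < r - 1}"

definition hyperstar :: "nat \<Rightarrow> nat \<Rightarrow> S_vertex hypergraph" where
  "hyperstar r t = (insert Center (\<Union>i<t. star_edge r i), {star_edge r i | i. i < t})"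

definition attached_edge :: "nat \<Rightarrow> nat \<Rightarrow> nat \<Rightarrow> S_vertex set" where
  "attached_edge r i j = insert (Star_Vertex i j) {Pendent_Vertex i j p | p. p < r - 1}"

definition S_hypertree :: "nat \<Rightarrow> nat list \<Rightarrow> S_vertex hypergraph" where
  "S_hypertree r as =
     (let P = {attached_edge r i j | i j. i < length as \<and> j < as ! i}
      in (verts (hyperstar r (length as)) \<union> \<Union>P, edges (hyperstar r (length as)) \<union> P))"

definition A_hypertree :: "nat \<Rightarrow> nat \<Rightarrow> nat \<Rightarrow> nat \<Rightarrow> S_vertex hypergraph" where
  "A_hypertree r q s l = S_hypertree r (replicate q (r - 1) @ [s] @ replicate l 0)"

text \<open>
  The first two conjuncts say that both fractions are defined; without them the convention
  \<open>1 / 0 = 0\<close> could create spurious roots.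
\<close>

definition is_root :: "nat \<Rightarrow> nat \<Rightarrow> nat \<Rightarrow> int \<Rightarrow> real \<Rightarrow> bool" where
  "is_root r q s l x \<longleftrightarrow> 1 - x \<noteq> 0 \<and> x ^ s \<noteq> 0 \<and>
     x ^ (r - 1) * (1 / (1 - x) - 1 / x ^ s - of_int l) = real q"

definition max_root :: "nat \<Rightarrow> nat \<Rightarrow> nat \<Rightarrow> int \<Rightarrow> real" where
  "max_root r q s l = (GREATEST x. is_root r q s l x)"

end

theory Submission
  imports Defs "HOL-Analysis.Analysis" "HOL-Combinatorics.Multiset_Permutations"
begin

text \<open>
  The spectral radius of an \<open>r\<close>-uniform hypergraph is the maximum of \<open>r \<Sum>\<^sub>e \<Prod>\<^sub>v\<^sub>\<in>\<^sub>e x v\<close>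
  over the nonnegative vectors with \<open>\<Sum>\<^sub>v x v ^ r = 1\<close> (\<open>spectral_radius_eq_maximum\<close>), and every
  maximizer of a connected hypergraph is positive (\<open>maximizer_pos\<close>).

  Fix the vertex set, take a tree of largest radius among those with \<open>m\<close> edges and a \<open>k\<close>-matching,
  and let \<open>v\<close> be a vertex at which its maximizer is largest. An edge \<open>e\<close> that avoids \<open>v\<close> can be
  detached at the vertex where it is joined to \<open>v\<close> and hung on \<open>v\<close> instead, together with everything
  behind it. The result is again a tree and has a strictly larger radius (\<open>reattach_increases\<close>), so
  it must have lost its \<open>k\<close>-matching. This can only happen if \<open>e\<close> belongs to every \<open>k\<close>-matching and
  each of them covers \<open>v\<close>. Hence the edges that avoid \<open>v\<close> are \<open>k - 1\<close> pairwise disjoint ones, and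
  some edge through \<open>v\<close> meets none of them (\<open>extremal_structure\<close>): the tree is an
  \<open>S(a\<^sub>1, \<dots>, a\<^sub>t)\<close> with \<open>t = m - k + 1\<close> and \<open>\<Sum> a\<^sub>i = k - 1\<close>.

  The radius of such a tree is bounded by a labelling of the incidences. If nonnegative labels have
  product \<open>\<alpha>\<close> along every edge and sum at most \<open>1\<close> at every vertex, the inequality between arithmetic
  and geometric means gives \<open>\<rho> \<le> \<alpha> powr (- 1 / r)\<close> (\<open>labelling_bound\<close>). Take \<open>\<alpha> = 1 - x\<close> with \<open>x\<close>
  the maximum root, label \<open>\<alpha>\<close> the incidence at which a pendent edge is attached and \<open>1 - \<alpha>\<close> the
  other incidence at that vertex; then an edge through \<open>v\<close> that carries \<open>a\<close> pendent edges needs the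
  label \<open>\<alpha> / x ^ a\<close> at \<open>v\<close>. Since \<open>a \<mapsto> (1 / x) ^ a\<close> is strictly convex and \<open>a\<^sub>i \<le> r - 1\<close>, the sum
  of these labels at \<open>v\<close> is largest exactly for the loads \<open>(r - 1)\<^sup>(\<^sup>q\<^sup>), s, 0\<^sup>(\<^sup>l\<^sup>)\<close>
  (\<open>load_sum_extremal\<close>), and for these loads it equals \<open>1\<close>: that is the equation that defines \<open>x\<close>.
  The bound is attained because on \<open>S((r - 1)\<^sup>(\<^sup>q\<^sup>), s, 0\<^sup>(\<^sup>l\<^sup>))\<close> all these inequalities are equalities for
  an explicit vector (\<open>S_hypertree_test_vector\<close>).

  Being a tree is used in one numerical form: a connected \<open>r\<close>-uniform hypergraph has
  at most \<open>1 + (r - 1) |E|\<close> vertices (\<open>vertex_bound\<close>), and a hypertree has exactly that many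
  (\<open>hypertree_vertex_count\<close>). Moving an edge then only has to preserve connectedness and the number
  of edges, and the linearity of the extremal tree is a consequence of the count, so no path or cycle
  has to be rerouted.
\<close>

section \<open>The spectral radius as a maximum\<close>

definition edge_sum :: "'a set set \<Rightarrow> ('a \<Rightarrow> real) \<Rightarrow> real" where
  "edge_sum E x = (\<Sum>e\<in>E. \<Prod>v\<in>e. x v)"

definition power_sum :: "nat \<Rightarrow> 'a set \<Rightarrow> ('a \<Rightarrow> real) \<Rightarrow> real" where
  "power_sum r V x = (\<Sum>v\<in>V. x v ^ r)"

text \<open>
  The left-hand side of the eigenvalue equation at \<open>i\<close>, and for real \<open>x\<close> the partial derivative
  of \<open>edge_sum E\<close> in direction \<open>i\<close>.
\<close>
definition link_sum :: "'a set set \<Rightarrow> ('a \<Rightarrow> 'b::comm_semiring_1) \<Rightarrow> 'a \<Rightarrow> 'b" where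
  "link_sum E x i = (\<Sum>e | e \<in> E \<and> i \<in> e. \<Prod>j\<in>e - {i}. x j)"

text \<open>
  Used to show that a perturbation by \<open>t\<close> that gains a term of order \<open>t ^ k\<close> and costs one of order
  \<open>t ^ n\<close> pays off for small \<open>t\<close>.
\<close>
lemma small_power_dominates:
  fixes a b :: real
  assumes "a > 0" "b \<ge> 0" "k < n"
  obtains t where "0 < t" "b * t ^ n < a * t ^ k"
proof -
  define t where "t = min 1 (a / (b + 1))"
  have t: "0 < t" "t \<le> 1" using assms by (auto simp: t_def)
  have "b * t < a"
  proof -
    have "b * t \<le> b * (a / (b + 1))" using assms by (intro mult_left_mono) (auto simp: t_def)
    also have "\<dots> < a" using assms by (simp add: field_simps)
    finally show ?thesis .
  qed
  moreover have "b * t ^ n \<le> b * t * t ^ k"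
  proof -
    have "t ^ n \<le> t ^ Suc k" using t assms by (intro power_decreasing) auto
    then show ?thesis using assms(2) by (simp add: mult_left_mono mult.assoc)
  qed
  ultimately have "b * t ^ n < a * t ^ k" using t
    by (smt (verit) mult_less_cancel_right_pos zero_less_power)
  then show ?thesis using that t by blast
qed

locale uniform_system =
  fixes r :: nat and V :: "'a set" and E :: "'a set set"
  assumes fin: "finite V" and nonempty: "V \<noteq> {}" and sub: "\<And>e. e \<in> E \<Longrightarrow> e \<subseteq> V"
    and unif: "\<And>e. e \<in> E \<Longrightarrow> card e = r" and r2: "r \<ge> 2"
begin

lemma finE: "finite E"
  using fin sub by (meson Pow_iff finite_Pow_iff finite_subset subsetI)

lemma fin_edge: "e \<in> E \<Longrightarrow> finite e"
  using fin sub finite_subset by blast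

lemma edge_nonempty: "e \<in> E \<Longrightarrow> e \<noteq> {}"
  using unif r2 by fastforce

text \<open>
  A list \<open>js\<close> with \<open>set (i # js) = e\<close> has no repetition, because \<open>i # js\<close> has as many entries as \<open>e\<close>
  has elements. So each edge through \<open>i\<close> is counted once for every ordering of its other vertices,
  and the factor \<open>1 / (r - 1)!\<close> cancels the number of orderings.
\<close>
lemma tensor_contraction:
  fixes x :: "'a \<Rightarrow> complex"
  assumes i: "i \<in> V"
  shows "(\<Sum>js | length js = r - 1 \<and> set js \<subseteq> V.
            adjacency_tensor r (V, E) (i # js) * prod_list (map x js)) = link_sum E x i"
proof -
  let ?L = "{js. length js = r - 1 \<and> set js \<subseteq> V}"
  let ?Ei = "{e \<in> E. i \<in> e}"
  let ?t = "\<lambda>js. adjacency_tensor r (V, E) (i # js) * prod_list (map x js)"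
  have finL: "finite ?L"
    using finite_lists_length_eq[OF fin, of "r - 1"] by (simp add: conj_commute)
  have perm: "{js \<in> ?L. insert i (set js) = e} = permutations_of_set (e - {i})"
    if e: "e \<in> ?Ei" for e
  proof (rule set_eqI, rule iffI)
    fix js assume js: "js \<in> {js \<in> ?L. insert i (set js) = e}"
    then have "card (set (i # js)) = length (i # js)" using e unif r2 by auto
    then have "distinct (i # js)" by (rule card_distinct)
    with js show "js \<in> permutations_of_set (e - {i})" by (auto intro!: permutations_of_setI)
  next
    fix js assume "js \<in> permutations_of_set (e - {i})"
    then have js: "set js = e - {i}" "distinct js" by (auto dest: permutations_of_setD)
    then have "length js = card (e - {i})" using distinct_card by metis
    also have "\<dots> = r - 1" using e unif fin_edge by auto
    finally show "js \<in> {js \<in> ?L. insert i (set js) = e}" using js e sub by auto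
  qed
  have "(\<Sum>js\<in>?L. ?t js) = (\<Sum>js | js \<in> ?L \<and> insert i (set js) \<in> ?Ei. ?t js)"
    by (rule sum.mono_neutral_right) (use finL in \<open>auto simp: adjacency_tensor_def\<close>)
  also have "\<dots> = (\<Sum>e\<in>?Ei. \<Sum>js | js \<in> {js. js \<in> ?L \<and> insert i (set js) \<in> ?Ei} \<and> insert i (set js) = e. ?t js)"
  proof (rule sum.group[symmetric])
    show "finite {js. js \<in> ?L \<and> insert i (set js) \<in> ?Ei}"
      by (rule finite_subset[OF _ finL]) auto
  qed (use finE in auto)
  also have "\<dots> = (\<Sum>e\<in>?Ei. \<Prod>j\<in>e - {i}. x j)"
  proof (rule sum.cong[OF refl])
    fix e assume e: "e \<in> ?Ei"
    have "(\<Sum>js | js \<in> {js. js \<in> ?L \<and> insert i (set js) \<in> ?Ei} \<and> insert i (set js) = e. ?t js)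
        = (\<Sum>js\<in>permutations_of_set (e - {i}). 1 / fact (r - 1) * (\<Prod>j\<in>e - {i}. x j))"
    proof (rule sum.cong)
      show "{js. js \<in> {js. js \<in> ?L \<and> insert i (set js) \<in> ?Ei} \<and> insert i (set js) = e}
          = permutations_of_set (e - {i})"
        using perm[OF e] e by auto
      fix js assume "js \<in> permutations_of_set (e - {i})"
      then have js: "set js = e - {i}" "distinct js" by (auto dest: permutations_of_setD)
      have "set (i # js) = e" using js e by auto
      then have "adjacency_tensor r (V, E) (i # js) = 1 / fact (r - 1)"
        using e unfolding adjacency_tensor_def by simp
      moreover have "prod_list (map x js) = (\<Prod>j\<in>e - {i}. x j)"
        using prod.distinct_set_conv_list[OF js(2), of x] js(1) by simp
      ultimately show "?t js = 1 / fact (r - 1) * (\<Prod>j\<in>e - {i}. x j)" by simp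
    qed
    also have "\<dots> = (\<Prod>j\<in>e - {i}. x j)"
      using e unif fin_edge by auto
    finally show "(\<Sum>js | js \<in> {js. js \<in> ?L \<and> insert i (set js) \<in> ?Ei} \<and> insert i (set js) = e. ?t js)
        = (\<Prod>j\<in>e - {i}. x j)" .
  qed
  finally show ?thesis by (simp add: link_sum_def)
qed

lemma sum_link_sum: "(\<Sum>i\<in>V. link_sum E x i * x i) = of_nat r * (\<Sum>e\<in>E. \<Prod>v\<in>e. x v)"
proof -
  have "(\<Sum>i\<in>V. link_sum E x i * x i) = (\<Sum>i\<in>V. \<Sum>e | e \<in> E \<and> i \<in> e. \<Prod>v\<in>e. x v)"
  proof (rule sum.cong[OF refl])
    fix i assume "i \<in> V"
    show "link_sum E x i * x i = (\<Sum>e | e \<in> E \<and> i \<in> e. \<Prod>v\<in>e. x v)"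
      unfolding link_sum_def sum_distrib_right
      by (rule sum.cong) (auto simp: prod.remove fin_edge mult.commute)
  qed
  also have "\<dots> = (\<Sum>e\<in>E. \<Sum>i | i \<in> V \<and> i \<in> e. \<Prod>v\<in>e. x v)"
    by (rule sum.swap_restrict) (use fin finE in auto)
  also have "\<dots> = (\<Sum>e\<in>E. of_nat r * (\<Prod>v\<in>e. x v))"
  proof (rule sum.cong[OF refl])
    fix e assume e: "e \<in> E"
    then have "{i. i \<in> V \<and> i \<in> e} = e" using sub by auto
    then show "(\<Sum>i | i \<in> V \<and> i \<in> e. \<Prod>v\<in>e. x v) = of_nat r * (\<Prod>v\<in>e. x v)"
      using e unif by simp
  qed
  finally show ?thesis by (simp add: sum_distrib_left)
qed

lemma power_sum_pos: assumes "\<And>v. v \<in> V \<Longrightarrow> 0 \<le> x v" "v \<in> V" "x v \<noteq> 0"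
  shows "power_sum r V x > 0"
proof -
  have "x v > 0" using assms by (simp add: less_le)
  then have "x v ^ r > 0" by simp
  then show ?thesis unfolding power_sum_def
    by (intro sum_pos2[OF fin \<open>v \<in> V\<close>]) (use assms(1) in auto)
qed

lemma power_sum_neq0: "power_sum r V x \<noteq> 0 \<Longrightarrow> \<exists>v\<in>V. x v \<noteq> 0"
proof (rule ccontr)
  assume ne: "power_sum r V x \<noteq> 0" and "\<not> (\<exists>v\<in>V. x v \<noteq> 0)"
  then have "x v ^ r = 0" if "v \<in> V" for v using that r2 by (auto simp: power_0_left)
  then have "power_sum r V x = 0" unfolding power_sum_def by (rule sum.neutral[OF ballI])
  with ne show False by simp
qed

lemma edge_sum_nonneg: assumes "\<And>v. v \<in> V \<Longrightarrow> 0 \<le> x v" shows "0 \<le> edge_sum E x"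
  unfolding edge_sum_def
proof (intro sum_nonneg prod_nonneg ballI)
  fix e v assume "e \<in> E" "v \<in> e"
  then have "v \<in> V" using sub by auto
  then show "0 \<le> x v" by (rule assms)
qed

text \<open>
  The last conjunct is the maximality of \<open>c\<close> without normalization: both sides are homogeneous of
  degree \<open>r\<close>, since every edge has \<open>r\<close> vertices.
\<close>
definition is_maximizer :: "real \<Rightarrow> ('a \<Rightarrow> real) \<Rightarrow> bool" where
  "is_maximizer c x \<longleftrightarrow> (\<forall>v\<in>V. 0 \<le> x v) \<and> power_sum r V x = 1 \<and> real r * edge_sum E x = c \<and>
     (\<forall>y. (\<forall>v\<in>V. 0 \<le> y v) \<longrightarrow> real r * edge_sum E y \<le> c * power_sum r V y)"

text \<open>
  The normalized vectors that vanish outside \<open>V\<close> form a compact set, because normalization forces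
  their entries into the unit interval. Homogeneity extends the maximality to all nonnegative vectors.
\<close>
lemma maximizer_exists: "\<exists>c x. is_maximizer c x"
proof -
  define K where "K = Pi\<^sub>E UNIV (\<lambda>v. if v \<in> V then {0..1::real} else {0})
                       \<inter> {x. power_sum r V x = 1}"
  have "compactin (product_topology (\<lambda>v. euclidean) UNIV) (Pi\<^sub>E UNIV (\<lambda>v. if v \<in> V then {0..1::real} else {0}))"
    by (subst compactin_PiE) auto
  then have cP: "compact (Pi\<^sub>E UNIV (\<lambda>v. if v \<in> V then {0..1::real} else {0}))"
    by (simp add: euclidean_product_topology)
  have co: "continuous_on UNIV (\<lambda>x. power_sum r V x)" "continuous_on UNIV (\<lambda>x. edge_sum E x)"
    unfolding power_sum_def edge_sum_def by (intro continuous_intros; simp)+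
  have cK: "compact K"
    unfolding K_def
    by (intro compact_Int_closed[OF cP] closed_Collect_eq co continuous_on_const)
  obtain v0 where v0: "v0 \<in> V" using nonempty by auto
  have "(\<lambda>v. if v = v0 then 1 else 0) \<in> K"
    using v0 fin r2 by (auto simp: K_def power_sum_def if_distrib[of "\<lambda>t. t ^ r"] power_0_left cong: if_cong)
  then have "K \<noteq> {}" by blast
  then obtain x where x: "x \<in> K" and xmax: "\<And>y. y \<in> K \<Longrightarrow> edge_sum E y \<le> edge_sum E x"
    using continuous_attains_sup[OF cK _ continuous_on_subset[OF co(2) subset_UNIV]] by metis
  have xnn: "\<forall>v\<in>V. 0 \<le> x v" using x by (auto simp: K_def PiE_def Pi_def split: if_splits)
  have "real r * edge_sum E y \<le> real r * edge_sum E x * power_sum r V y"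
    if ynn: "\<forall>v\<in>V. 0 \<le> y v" for y
  proof (cases "\<exists>v\<in>V. y v \<noteq> 0")
    case False
    then have "(\<Prod>v\<in>e. y v) = 0" if "e \<in> E" for e
      using that sub edge_nonempty fin_edge by (metis ex_in_conv prod_zero subsetD)
    then show ?thesis using False r2
      by (simp add: edge_sum_def power_sum_def power_0_left)
  next
    case True
    then have P: "power_sum r V y > 0" using power_sum_pos ynn by blast
    define c where "c = root r (power_sum r V y)"
    have c: "c > 0" "c ^ r = power_sum r V y" using P r2 by (auto simp: c_def)
    define z where "z = (\<lambda>v. if v \<in> V then y v / c else 0)"
    have zP: "power_sum r V z = 1"
      using c P by (simp add: z_def power_sum_def power_divide flip: sum_divide_distrib)
    have "z v \<le> 1" if v: "v \<in> V" for v
    proof -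
      have "z v ^ r \<le> power_sum r V z" unfolding power_sum_def
        by (rule member_le_sum) (use v fin ynn c in \<open>auto simp: z_def\<close>)
      then have "z v ^ r \<le> 1 ^ r" using zP by simp
      then show ?thesis using r2 by (subst (asm) power_mono_iff) (use v ynn c in \<open>auto simp: z_def\<close>)
    qed
    then have "z \<in> K" using zP ynn c by (auto simp: K_def z_def)
    then have le: "edge_sum E z \<le> edge_sum E x" by (rule xmax)
    have "edge_sum E z = edge_sum E y / c ^ r"
      unfolding edge_sum_def sum_divide_distrib
    proof (rule sum.cong[OF refl])
      fix e assume e: "e \<in> E"
      have "(\<Prod>v\<in>e. z v) = (\<Prod>v\<in>e. y v / c)"
        by (rule prod.cong) (use e sub in \<open>auto simp: z_def\<close>)
      then show "(\<Prod>v\<in>e. z v) = (\<Prod>v\<in>e. y v) / c ^ r"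
        using e unif by (simp add: prod_dividef)
    qed
    then have "edge_sum E y = edge_sum E z * power_sum r V y" using c P by simp
    also have "\<dots> \<le> edge_sum E x * power_sum r V y" using le P by (simp add: mult_right_mono)
    finally have "edge_sum E y \<le> edge_sum E x * power_sum r V y" .
    then show ?thesis using mult_left_mono[of _ _ "real r"] by (simp add: mult.assoc)
  qed
  then have "is_maximizer (real r * edge_sum E x) x"
    using x xnn by (auto simp: is_maximizer_def K_def)
  then show ?thesis by blast
qed

lemma maximizer_nonneg:
  assumes "is_maximizer c x" shows "0 \<le> c"
proof -
  have "0 \<le> edge_sum E x" using assms by (intro edge_sum_nonneg) (simp add: is_maximizer_def)
  then have "0 \<le> real r * edge_sum E x" by simp
  then show ?thesis using assms by (simp add: is_maximizer_def)
qed

lemma edge_sum_split: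
  assumes "i \<in> V"
  shows "edge_sum E x = x i * link_sum E x i + edge_sum {e \<in> E. i \<notin> e} x"
proof -
  have "edge_sum E x = edge_sum {e \<in> E. i \<in> e} x + edge_sum {e \<in> E. i \<notin> e} x"
    unfolding edge_sum_def
    by (subst sum.union_disjoint[symmetric]) (use finE in \<open>auto intro: sum.cong\<close>)
  moreover have "edge_sum {e \<in> E. i \<in> e} x = x i * link_sum E x i"
    unfolding edge_sum_def link_sum_def sum_distrib_left
    by (rule sum.cong) (auto simp: prod.remove fin_edge)
  ultimately show ?thesis by simp
qed

lemma link_sum_upd: "link_sum E (x(i := t)) i = link_sum E x i"
  unfolding link_sum_def by (intro sum.cong prod.cong) auto

lemma edge_sum_upd:
  assumes "i \<in> V"
  shows "edge_sum E (x(i := t)) = t * link_sum E x i + edge_sum {e \<in> E. i \<notin> e} x"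
proof -
  have "edge_sum {e \<in> E. i \<notin> e} (x(i := t)) = edge_sum {e \<in> E. i \<notin> e} x"
    unfolding edge_sum_def by (intro sum.cong prod.cong) auto
  then show ?thesis using edge_sum_split[OF assms, of "x(i := t)"] by (simp add: link_sum_upd)
qed

lemma power_sum_upd:
  assumes "i \<in> V"
  shows "power_sum r V (x(i := t)) = t ^ r + power_sum r (V - {i}) x"
  unfolding power_sum_def
  by (subst sum.remove[OF fin assms]) (auto intro: sum.cong)

text \<open>
  Only the entry at \<open>i\<close> is varied. If it is positive, this is the vanishing of a partial
  derivative. If it is \<open>0\<close>, a positive \<open>link_sum\<close> would give a gain linear in the new entry \<open>t\<close>
  against a cost of order \<open>t ^ r\<close>.
\<close>
lemma maximizer_eigen:
  assumes mx: "is_maximizer c x" and i: "i \<in> V"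
  shows "link_sum E x i = c * x i ^ (r - 1)"
proof -
  let ?a = "link_sum E x i" and ?d = "edge_sum {e \<in> E. i \<notin> e} x" and ?s = "power_sum r (V - {i}) x"
  have xnn: "\<forall>v\<in>V. 0 \<le> x v" and x1: "power_sum r V x = 1" and xc: "real r * edge_sum E x = c"
    and opt: "\<And>y. (\<forall>v\<in>V. 0 \<le> y v) \<Longrightarrow> real r * edge_sum E y \<le> c * power_sum r V y"
    using mx by (auto simp: is_maximizer_def)
  have ge: "real r * (t * ?a + ?d) \<le> c * (t ^ r + ?s)" if "t \<ge> 0" for t
    using opt[of "x(i := t)"] that xnn edge_sum_upd[OF i, of x t] power_sum_upd[OF i, of x t] by simp
  have eq: "real r * (x i * ?a + ?d) = c * (x i ^ r + ?s)"
    using xc x1 edge_sum_upd[OF i, of x "x i"] power_sum_upd[OF i, of x "x i"] by simp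
  have ann: "?a \<ge> 0" unfolding link_sum_def
  proof (intro sum_nonneg prod_nonneg ballI)
    fix e j assume "e \<in> {e \<in> E. i \<in> e}" "j \<in> e - {i}"
    then have "j \<in> V" using sub[of e] by auto
    then show "0 \<le> x j" using xnn by simp
  qed
  show ?thesis
  proof (cases "x i = 0")
    case True
    have "\<not> ?a > 0"
    proof
      assume "?a > 0"
      then have "real r * ?a > 0" using r2 by simp
      then obtain t where t: "t > 0" "c * t ^ r < (real r * ?a) * t ^ 1"
        using small_power_dominates[of "real r * ?a" c 1 r] maximizer_nonneg[OF mx] r2 by auto
      show False using ge[of t] eq t True r2 by (simp add: algebra_simps power_0_left)
    qed
    then show ?thesis using ann True r2 by (simp add: power_0_left)
  next
    case False
    then have pos: "x i > 0" using xnn i by (simp add: less_le)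
    define g where "g = (\<lambda>t. c * (t ^ r + ?s) - real r * (t * ?a + ?d))"
    have "DERIV g (x i) :> c * (real r * x i ^ (r - 1)) - real r * ?a"
      unfolding g_def by (auto intro!: derivative_eq_intros)
    then have "c * (real r * x i ^ (r - 1)) - real r * ?a = 0"
      by (rule DERIV_local_min[OF _ pos]) (use ge eq in \<open>auto simp: g_def\<close>)
    then show ?thesis using r2 by auto
  qed
qed

text \<open>
  The maximum is an eigenvalue by \<open>maximizer_eigen\<close>. It bounds every eigenvalue \<open>c'\<close> with eigenvector
  \<open>z\<close>: multiply the absolute values of the equations by \<open>cmod (z i)\<close> and sum over \<open>i\<close>, which tests
  the maximality on the vector of absolute values.
\<close>
lemma spectral_radius_eq_maximum:
  assumes mx: "is_maximizer c x"
  shows "spectral_radius r (V, E) = c"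
  unfolding spectral_radius_def
proof (rule Greatest_equality)
  have xnn: "\<forall>v\<in>V. 0 \<le> x v" and x1: "power_sum r V x = 1"
    and opt: "\<And>y. (\<forall>v\<in>V. 0 \<le> y v) \<Longrightarrow> real r * edge_sum E y \<le> c * power_sum r V y"
    using mx by (auto simp: is_maximizer_def)
  have "tensor_eigenvalue r V (adjacency_tensor r (V, E)) (of_real c)"
    unfolding tensor_eigenvalue_def
  proof (intro exI conjI ballI)
    let ?z = "\<lambda>v. complex_of_real (x v)"
    show "\<exists>i\<in>V. ?z i \<noteq> 0" using x1 power_sum_neq0[of x] by simp
    fix i assume i: "i \<in> V"
    have "link_sum E ?z i = of_real (link_sum E x i)"
      unfolding link_sum_def by simp
    then show "(\<Sum>js | length js = r - 1 \<and> set js \<subseteq> V.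
        adjacency_tensor r (V, E) (i # js) * prod_list (map ?z js)) = of_real c * ?z i ^ (r - 1)"
      using tensor_contraction[OF i, of ?z] maximizer_eigen[OF mx i] by simp
  qed
  then show "\<exists>c'. tensor_eigenvalue r (verts (V, E)) (adjacency_tensor r (V, E)) c' \<and> c = cmod c'"
    using maximizer_nonneg[OF mx] by (intro exI[of _ "of_real c"]) simp
next
  fix d assume "\<exists>c'. tensor_eigenvalue r (verts (V, E)) (adjacency_tensor r (V, E)) c' \<and> d = cmod c'"
  then obtain c' where d: "d = cmod c'"
    and "tensor_eigenvalue r V (adjacency_tensor r (V, E)) c'" by auto
  then obtain z where z0: "\<exists>i\<in>V. z i \<noteq> 0"
    and z: "\<forall>i\<in>V. (\<Sum>js | length js = r - 1 \<and> set js \<subseteq> V.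
        adjacency_tensor r (V, E) (i # js) * prod_list (map z js)) = c' * z i ^ (r - 1)"
    unfolding tensor_eigenvalue_def by blast
  have eig: "link_sum E z i = c' * z i ^ (r - 1)" if "i \<in> V" for i
    using bspec[OF z that] by (simp only: tensor_contraction[OF that])
  define y where "y = (\<lambda>v. cmod (z v))"
  have yP: "power_sum r V y > 0" using power_sum_pos[of y] z0 by (auto simp: y_def)
  have "d * power_sum r V y = (\<Sum>i\<in>V. cmod (link_sum E z i) * y i)"
  proof -
    have "d * y i ^ r = cmod (link_sum E z i) * y i" if "i \<in> V" for i
    proof -
      have "y i ^ r = y i ^ (r - 1) * y i" using r2 by (metis Suc_1 Suc_le_D diff_Suc_1 power_Suc2)
      then show ?thesis using eig[OF that] by (simp add: norm_mult norm_power d y_def)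
    qed
    then show ?thesis by (simp add: power_sum_def sum_distrib_left)
  qed
  also have "\<dots> \<le> (\<Sum>i\<in>V. link_sum E y i * y i)"
    unfolding link_sum_def y_def
    by (intro sum_mono mult_right_mono order.trans[OF norm_sum]) (auto simp: prod_norm)
  also have "\<dots> = real r * edge_sum E y" by (simp add: sum_link_sum edge_sum_def)
  also have "\<dots> \<le> c * power_sum r V y"
    using mx by (simp add: is_maximizer_def y_def)
  finally show "d \<le> c" using yP by simp
qed

abbreviation "\<rho> \<equiv> spectral_radius r (V, E)"

lemma maximizer_obtain: obtains x where "is_maximizer \<rho> x"
proof -
  obtain c x where cx: "is_maximizer c x" using maximizer_exists by blast
  show ?thesis by (rule that) (use cx spectral_radius_eq_maximum[OF cx] in simp)
qed

lemma rayleigh: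
  assumes "\<And>v. v \<in> V \<Longrightarrow> 0 \<le> y v"
  shows "real r * edge_sum E y \<le> \<rho> * power_sum r V y"
proof -
  obtain x where "is_maximizer \<rho> x" by (rule maximizer_obtain)
  then show ?thesis using assms by (simp add: is_maximizer_def)
qed

lemma maximizerI:
  assumes "\<And>v. v \<in> V \<Longrightarrow> 0 \<le> y v" "power_sum r V y = 1" "real r * edge_sum E y = \<rho>"
  shows "is_maximizer \<rho> y"
  using assms rayleigh by (auto simp: is_maximizer_def)

end

section \<open>Connectedness and weighted incidences\<close>

text \<open>
  Connectedness without walks: a set of vertices that no edge crosses is trivial. In this form it is
  easily checked after an edge has been replaced.
\<close>
definition cut_connected :: "'a set \<Rightarrow> 'a set set \<Rightarrow> bool" where
  "cut_connected V E \<longleftrightarrow>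
     (\<forall>S\<subseteq>V. (\<forall>e\<in>E. e \<subseteq> S \<or> e \<inter> S = {}) \<longrightarrow> S = {} \<or> S = V)"

context uniform_system
begin

lemma crossing_edge:
  assumes "cut_connected V E" "S \<subseteq> V" "S \<noteq> {}" "S \<noteq> V"
  obtains e where "e \<in> E" "\<not> e \<subseteq> S" "e \<inter> S \<noteq> {}"
proof -
  have "\<not> (\<forall>e\<in>E. e \<subseteq> S \<or> e \<inter> S = {})"
    using assms unfolding cut_connected_def by blast
  then show ?thesis using that by blast
qed

text \<open>
  If the zero set of a maximizer were a nontrivial cut, some edge would have \<open>k < r\<close> vertices in it
  and others outside. Raising those \<open>k\<close> entries to \<open>t\<close> gains a term of order \<open>t ^ k\<close> on that edge and
  costs only \<open>k t ^ r\<close> in the normalization.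
\<close>
lemma maximizer_pos:
  assumes con: "cut_connected V E" and mx: "is_maximizer c x" and v: "v \<in> V"
  shows "x v > 0"
proof (rule ccontr)
  have xnn: "\<forall>v\<in>V. 0 \<le> x v" and x1: "power_sum r V x = 1" and xc: "real r * edge_sum E x = c"
    and opt: "\<And>y. (\<forall>v\<in>V. 0 \<le> y v) \<Longrightarrow> real r * edge_sum E y \<le> c * power_sum r V y"
    using mx by (auto simp: is_maximizer_def)
  let ?Z = "{v \<in> V. x v = 0}"
  assume "\<not> x v > 0"
  then have "?Z \<noteq> {}" using xnn v by force
  moreover have "\<exists>v\<in>V. x v \<noteq> 0" using x1 power_sum_neq0[of x] by simp
  then have "?Z \<noteq> V" by blast
  moreover have "?Z \<subseteq> V" by auto
  ultimately obtain e where e: "e \<in> E" "\<not> e \<subseteq> ?Z" "e \<inter> ?Z \<noteq> {}"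
    using crossing_edge[OF con] by blast
  define W where "W = e \<inter> ?Z"
  define k where "k = card W"
  have W: "finite W" "W \<subseteq> e" "W \<subset> e" using e fin_edge by (auto simp: W_def)
  have k: "k < r" using psubset_card_mono[OF fin_edge[OF e(1)] W(3)] unif e by (simp add: k_def)
  define d where "d = (\<Prod>v\<in>e - W. x v)"
  have d: "d > 0" unfolding d_def
    using xnn sub[OF e(1)] by (intro prod_pos) (auto simp: W_def less_le)
  have "real r * d > 0" using d r2 by simp
  then obtain t where t: "t > 0" "c * real k * t ^ r < (real r * d) * t ^ k"
    using small_power_dominates[of "real r * d" "c * real k" k r] k maximizer_nonneg[OF mx] by auto
  define y where "y = (\<lambda>v. if v \<in> W then t else x v)"
  have xy: "x v \<le> y v" if "v \<in> V" for v using t by (auto simp: y_def W_def)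
  have "edge_sum E y \<ge> edge_sum E x + t ^ k * d"
  proof -
    have "(\<Prod>v\<in>e. y v) = (\<Prod>v\<in>W. y v) * (\<Prod>v\<in>e - W. y v)"
      using W fin_edge[OF e(1)] by (metis prod.subset_diff mult.commute)
    also have "(\<Prod>v\<in>W. y v) = t ^ k" by (simp add: y_def k_def)
    also have "(\<Prod>v\<in>e - W. y v) = d" unfolding d_def by (rule prod.cong) (auto simp: y_def)
    finally have ye: "(\<Prod>v\<in>e. y v) = t ^ k * d" .
    have xe: "(\<Prod>v\<in>e. x v) = 0" using e fin_edge[OF e(1)] by (intro prod_zero) auto
    have "(\<Sum>f\<in>E - {e}. \<Prod>v\<in>f. x v) \<le> (\<Sum>f\<in>E - {e}. \<Prod>v\<in>f. y v)"
    proof (intro sum_mono prod_mono ballI conjI)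
      fix f v assume "f \<in> E - {e}" "v \<in> f"
      then have "v \<in> V" using sub[of f] by auto
      then show "0 \<le> x v" "x v \<le> y v" using xnn xy by auto
    qed
    then show ?thesis unfolding edge_sum_def
      using ye xe by (simp add: sum.remove[OF finE e(1)])
  qed
  moreover have "power_sum r V y = power_sum r V x + real k * t ^ r"
  proof -
    have WV: "W \<subseteq> V" by (auto simp: W_def)
    have "(\<Sum>v\<in>V - W. y v ^ r) = (\<Sum>v\<in>V - W. x v ^ r)" by (rule sum.cong) (auto simp: y_def)
    moreover have "(\<Sum>v\<in>W. y v ^ r) = real k * t ^ r" by (simp add: y_def k_def)
    moreover have "(\<Sum>v\<in>W. x v ^ r) = 0" using r2 by (simp add: W_def power_0_left)
    ultimately show ?thesis unfolding power_sum_def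
      using sum.subset_diff[OF WV fin, of "\<lambda>v. y v ^ r"] sum.subset_diff[OF WV fin, of "\<lambda>v. x v ^ r"]
      by simp
  qed
  moreover have "real r * edge_sum E y \<le> c * power_sum r V y"
    using opt[of y] xy xnn by force
  ultimately have "real r * (edge_sum E x + t ^ k * d) \<le> c * (power_sum r V x + real k * t ^ r)"
    using mult_left_mono[of "edge_sum E x + t ^ k * d" "edge_sum E y" "real r"]
    by (metis of_nat_0_le_iff order_trans)
  then show False using t x1 xc by (simp add: algebra_simps)
qed

text \<open>
  The inequality between arithmetic and geometric means on each edge \<open>e\<close>, applied to the numbers
  \<open>B v e * x v ^ r\<close>, whose product is \<open>\<alpha>\<close> times the \<open>r\<close>-th power of the term of \<open>e\<close> in \<open>edge_sum E x\<close>.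
\<close>
lemma labelling_bound:
  fixes B :: "'a \<Rightarrow> 'a set \<Rightarrow> real"
  assumes Bnn: "\<And>e v. e \<in> E \<Longrightarrow> v \<in> e \<Longrightarrow> 0 \<le> B v e"
    and prd: "\<And>e. e \<in> E \<Longrightarrow> (\<Prod>v\<in>e. B v e) = \<alpha>"
    and xnn: "\<And>v. v \<in> V \<Longrightarrow> 0 \<le> x v"
  shows "\<alpha> powr (1 / r) * (real r * edge_sum E x) \<le> (\<Sum>v\<in>V. (\<Sum>e | e \<in> E \<and> v \<in> e. B v e) * x v ^ r)"
proof -
  have "(\<Sum>v\<in>V. (\<Sum>e | e \<in> E \<and> v \<in> e. B v e) * x v ^ r)
      = (\<Sum>v\<in>V. \<Sum>e | e \<in> E \<and> v \<in> e. B v e * x v ^ r)" by (simp add: sum_distrib_right)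
  also have "\<dots> = (\<Sum>e\<in>E. \<Sum>v | v \<in> V \<and> v \<in> e. B v e * x v ^ r)"
    by (rule sum.swap_restrict) (use fin finE in auto)
  also have "\<dots> \<ge> (\<Sum>e\<in>E. \<alpha> powr (1 / r) * (real r * (\<Prod>v\<in>e. x v)))"
  proof (rule sum_mono)
    fix e assume e: "e \<in> E"
    have eV: "{v. v \<in> V \<and> v \<in> e} = e" using sub[OF e] by auto
    have nn: "0 \<le> x v" if "v \<in> e" for v using xnn sub[OF e] that by auto
    have "(\<Prod>v\<in>e. B v e * x v ^ r) powr (1 / card e) \<le> (\<Sum>v\<in>e. B v e * x v ^ r / card e)"
      by (rule arith_geom_mean) (use fin_edge[OF e] edge_nonempty[OF e] Bnn[OF e] nn in auto)
    moreover have "(\<Prod>v\<in>e. B v e * x v ^ r) = \<alpha> * (\<Prod>v\<in>e. x v) ^ r"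
      using prd[OF e] by (simp add: prod.distrib prod_power_distrib)
    moreover have "0 \<le> \<alpha>" using prd[OF e] Bnn[OF e] by (metis prod_nonneg)
    moreover have xp: "0 \<le> (\<Prod>v\<in>e. x v)" using nn by (intro prod_nonneg) auto
    moreover have "((\<Prod>v\<in>e. x v) ^ r) powr (1 / real r) = (\<Prod>v\<in>e. x v)"
      using r2 xp by (simp add: root_powr_inverse[symmetric] real_root_power_cancel)
    ultimately have "\<alpha> powr (1 / r) * (\<Prod>v\<in>e. x v) \<le> (\<Sum>v\<in>e. B v e * x v ^ r) / real r"
      using unif[OF e] by (simp add: powr_mult sum_divide_distrib)
    then show "\<alpha> powr (1 / r) * (real r * (\<Prod>v\<in>e. x v)) \<le> (\<Sum>v | v \<in> V \<and> v \<in> e. B v e * x v ^ r)"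
      using r2 unfolding eV by (simp add: field_simps)
  qed
  finally show ?thesis by (simp add: edge_sum_def sum_distrib_left)
qed

end

section \<open>Counting the vertices of hypertrees\<close>

lemma walk_stays:
  assumes w: "walk (V, E) vs es" and S: "\<forall>e\<in>E. e \<subseteq> S \<or> e \<inter> S = {}" and h: "hd vs \<in> S"
  shows "set vs \<subseteq> S"
proof -
  have len: "length vs = length es + 1" using w by (simp add: walk_def)
  have "vs ! i \<in> S" if "i < length vs" for i
    using that
  proof (induction i)
    case 0
    then show ?case using h by (cases vs) auto
  next
    case (Suc i)
    then have i: "i < length es" using len by simp
    then have "es ! i \<in> E" "vs ! i \<in> es ! i" "vs ! Suc i \<in> es ! i"
      using w by (auto simp: walk_def)
    then show ?case using S Suc by force
  qed
  then show ?thesis by (auto simp: set_conv_nth)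
qed

lemma connected_imp_cut_connected:
  assumes con: "connected_hypergraph (V, E)"
  shows "cut_connected V E"
  unfolding cut_connected_def
proof (intro allI impI)
  fix S assume SV: "S \<subseteq> V" and S: "\<forall>e\<in>E. e \<subseteq> S \<or> e \<inter> S = {}"
  show "S = {} \<or> S = V"
  proof (rule ccontr)
    assume "\<not> (S = {} \<or> S = V)"
    then obtain u w where u: "u \<in> S" and w: "w \<in> V" "w \<notin> S" using SV by auto
    then obtain vs es where p: "Defs.path (V, E) vs es" "hd vs = u" "last vs = w"
      using con SV unfolding connected_hypergraph_def by (metis fst_conv subsetD)
    then have wk: "walk (V, E) vs es" by (simp add: Defs.path_def)
    then have "vs \<noteq> []" by (auto simp: walk_def)
    then have "last vs \<in> S" using walk_stays[OF wk S] p u last_in_set by blast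
    then show False using p w by simp
  qed
qed

lemma path_mono: "Defs.path (S, D) vs es \<Longrightarrow> S \<subseteq> S' \<Longrightarrow> D \<subseteq> D' \<Longrightarrow> Defs.path (S', D') vs es"
  by (auto simp: Defs.path_def walk_def)

lemma path_snoc:
  assumes p: "Defs.path (S, D) vs es" and "last vs \<in> e" "w \<in> e" "w \<notin> S" "e \<notin> D"
  shows "Defs.path (S \<union> e, insert e D) (vs @ [w]) (es @ [e])"
proof -
  have len: "length vs = length es + 1" using p by (simp add: Defs.path_def walk_def)
  then have "vs ! length es = last vs" by (metis add_diff_cancel_right' last_conv_nth length_0_conv add_is_0 one_neq_zero)
  then show ?thesis using assms len
    by (auto simp: Defs.path_def walk_def nth_append less_Suc_eq)
qed

lemma path_cons:
  assumes p: "Defs.path (S, D) vs es" and "hd vs \<in> e" "w \<in> e" "w \<notin> S" "e \<notin> D"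
  shows "Defs.path (S \<union> e, insert e D) (w # vs) (e # es)"
proof -
  have len: "length vs = length es + 1" using p by (simp add: Defs.path_def walk_def)
  then have "vs ! 0 = hd vs" by (metis hd_conv_nth length_0_conv add_is_0 one_neq_zero)
  then show ?thesis using assms len
    by (auto simp: Defs.path_def walk_def less_Suc_eq_0_disj)
qed

text \<open>
  An edge that meets a connected part in two vertices closes a cycle.
\<close>
lemma cycle_from_path:
  assumes p: "Defs.path (S, D) vs es" and ab: "hd vs = a" "last vs = b" "a \<noteq> b" "a \<in> e" "b \<in> e"
    and e: "e \<in> E" "e \<notin> D" and sub: "S \<subseteq> V" "D \<subseteq> E"
  shows "cycle (V, E) (vs @ [a]) (es @ [e])"
proof -
  have len: "length vs = length es + 1" using p by (simp add: Defs.path_def walk_def)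
  then have ne: "vs \<noteq> []" by auto
  have l: "vs ! length es = b" using ab len by (metis add_diff_cancel_right' last_conv_nth ne)
  have "es \<noteq> []" using ab len by (cases vs) auto
  moreover have "a \<in> set vs" using ab ne by auto
  ultimately show ?thesis
    using p ab e sub len ne l unfolding Defs.path_def walk_def cycle_def
    by (auto simp: nth_append less_Suc_eq Suc_le_eq hd_append)
qed

context uniform_system
begin

lemma card_Un_edge:
  assumes "e \<in> E" "S \<subseteq> V"
  shows "card (S \<union> e) + card (e \<inter> S) = card S + r"
  using card_Un_Int[of S e] fin_edge[OF assms(1)] finite_subset[OF assms(2) fin] unif[OF assms(1)]
  by (simp add: Int_commute)

text \<open>
  Grow \<open>S\<close> by an edge that crosses its boundary: the edge has not been counted before, and it brings
  at most \<open>r - 1\<close> new vertices.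
\<close>
lemma vertex_bound:
  assumes con: "cut_connected V E"
  shows "\<lbrakk>S \<subseteq> V; S \<noteq> {}; D \<subseteq> E; \<Union>D \<subseteq> S\<rbrakk> \<Longrightarrow> card V \<le> card S + (r - 1) * card (E - D)"
proof (induction "card (V - S)" arbitrary: S D rule: less_induct)
  case less
  show ?case
  proof (cases "S = V")
    case True
    then show ?thesis by simp
  next
    case False
    then obtain e where e: "e \<in> E" "\<not> e \<subseteq> S" "e \<inter> S \<noteq> {}"
      using crossing_edge[OF con] less.prems by metis
    have eD: "e \<in> E - D" using e less.prems by auto
    have "card (V - (S \<union> e)) < card (V - S)"
      using e sub fin by (intro psubset_card_mono) auto
    then have IH: "card V \<le> card (S \<union> e) + (r - 1) * card (E - insert e D)"
      by (rule less.hyps) (use less.prems e sub in auto)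
    have "card (e \<inter> S) \<ge> 1" using e fin_edge by (simp add: Suc_leI card_gt_0_iff)
    then have "card (S \<union> e) \<le> card S + (r - 1)"
      using card_Un_edge[OF e(1) less.prems(1)] by simp
    moreover have "card (E - D) = Suc (card (E - insert e D))"
      using card.remove[OF _ eD] finE by (simp add: Diff_insert[of E e D])
    ultimately show ?thesis using IH by simp
  qed
qed

text \<open>
  Grow a vertex set \<open>S\<close> and the set \<open>D\<close> of edges used so far, keeping \<open>S\<close> connected by paths in
  \<open>D\<close>. A new edge meets \<open>S\<close> in exactly one vertex, since otherwise it would close a cycle; it thus
  brings exactly \<open>r - 1\<close> new vertices.
\<close>
lemma hypertree_vertex_count:
  assumes con: "cut_connected V E" and acyc: "\<And>vs es. \<not> cycle (V, E) vs es"
  shows "card V = 1 + (r - 1) * card E"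
proof -
  have "card V = 1 + (r - 1) * card E"
    if "S \<subseteq> V" "S \<noteq> {}" "D \<subseteq> E" "\<Union>D \<subseteq> S" "card S = 1 + (r - 1) * card D"
      "\<And>a b. a \<in> S \<Longrightarrow> b \<in> S \<Longrightarrow> \<exists>vs es. Defs.path (S, D) vs es \<and> hd vs = a \<and> last vs = b" for S D
    using that
  proof (induction "card (V - S)" arbitrary: S D rule: less_induct)
    case less
    have one: "a = b" if "e \<in> E" "e \<notin> D" "a \<in> e \<inter> S" "b \<in> e \<inter> S" for a b e
      using less.prems(6)[of a b] cycle_from_path[of S D _ _ a b e E V] acyc that less.prems(1,3) by blast
    show ?case
    proof (cases "S = V")
      case True
      have "E \<subseteq> D"
      proof (rule ccontr)
        assume "\<not> E \<subseteq> D"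
        then obtain e where e: "e \<in> E" "e \<notin> D" by auto
        then have "\<forall>a\<in>e. \<forall>b\<in>e. a = b" using one sub True by blast
        then have "card e \<le> 1" using card_le_Suc0_iff_eq[OF fin_edge[OF e(1)]] by simp
        then show False using unif[OF e(1)] r2 by simp
      qed
      then show ?thesis using less.prems True by auto
    next
      case False
      then obtain e where e: "e \<in> E" "\<not> e \<subseteq> S" "e \<inter> S \<noteq> {}"
        using crossing_edge[OF con] less.prems by metis
      then obtain u where u: "u \<in> e \<inter> S" by blast
      have eD: "e \<notin> D" using e less.prems by auto
      have eS: "e \<inter> S = {u}" using one[OF e(1) eD] u by blast
      show ?thesis
      proof (rule less.hyps[of "S \<union> e" "insert e D"])
        show "card (V - (S \<union> e)) < card (V - S)"
          using e sub fin by (intro psubset_card_mono) auto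
        show "card (S \<union> e) = 1 + (r - 1) * card (insert e D)"
        proof -
          have "card (S \<union> e) = card S + (r - 1)"
            using card_Un_edge[OF e(1) less.prems(1)] eS r2 by simp
          moreover have "finite D" using less.prems finE finite_subset by blast
          ultimately show ?thesis using eD less.prems(5) by simp
        qed
        fix a b assume a: "a \<in> S \<union> e" and b: "b \<in> S \<union> e"
        consider "a \<in> S" "b \<in> S" | "a \<in> S" "b \<notin> S" | "a \<notin> S" "b \<in> S" | "a \<notin> S" "b \<notin> S" by blast
        then show "\<exists>vs es. Defs.path (S \<union> e, insert e D) vs es \<and> hd vs = a \<and> last vs = b"
        proof cases
          case 1
          then show ?thesis using less.prems(6) path_mono by (metis Un_upper1 subset_insertI)
        next
          case 2
          then obtain vs es where p: "Defs.path (S, D) vs es" "hd vs = a" "last vs = u"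
            using less.prems(6)[of a u] u by blast
          then have "Defs.path (S \<union> e, insert e D) (vs @ [b]) (es @ [e])"
            using path_snoc[OF p(1)] u b 2 eD by auto
          moreover have "vs \<noteq> []" using p(1) by (auto simp: Defs.path_def walk_def)
          ultimately show ?thesis using p by (metis hd_append2 last_snoc)
        next
          case 3
          then obtain vs es where p: "Defs.path (S, D) vs es" "hd vs = u" "last vs = b"
            using less.prems(6)[of u b] u by blast
          then have "Defs.path (S \<union> e, insert e D) (a # vs) (e # es)"
            using path_cons[OF p(1)] u a 3 eD by auto
          moreover have "vs \<noteq> []" using p(1) by (auto simp: Defs.path_def walk_def)
          ultimately show ?thesis using p by (metis last_ConsR list.sel(1))
        next
          case 4
          show ?thesis
          proof (cases "a = b")
            case True
            then have "Defs.path (S \<union> e, insert e D) [a] []" using a by (auto simp: Defs.path_def walk_def)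
            then show ?thesis using True by force
          next
            case False
            then have "Defs.path (S \<union> e, insert e D) [a, b] [e]"
              using a b 4 by (auto simp: Defs.path_def walk_def)
            then show ?thesis by force
          qed
        qed
      qed (use less.prems e sub in auto)
    qed
  qed
  note grow = this
  obtain v where v: "v \<in> V" using nonempty by auto
  have "Defs.path ({v}, {}) [v] []" by (auto simp: Defs.path_def walk_def)
  then have pv: "\<exists>vs es. Defs.path ({v}, {}) vs es \<and> hd vs = v \<and> last vs = v" by force
  show ?thesis using grow[of "{v}" "{}"] v pv by simp
qed

end

section \<open>Moving an edge to a heavier vertex\<close>

context uniform_system
begin

text \<open>
  The vertex \<open>u\<close> is one at which \<open>e\<close> can be reached from \<open>v\<close> without using \<open>e\<close>. A set that the new
  edges do not cross has \<open>u\<close> and \<open>v\<close> on the same side, so it was not crossed by \<open>e\<close> either.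
\<close>
lemma reattach_connected:
  assumes con: "cut_connected V E" and e: "e \<in> E" and v: "v \<in> V"
  obtains u where "u \<in> e" "cut_connected V (insert (insert v (e - {u})) (E - {e}))"
proof -
  define R where "R = {(a, b). \<exists>f\<in>E - {e}. a \<in> f \<and> b \<in> f}"
  \<comment> \<open>the vertices that are joined to \<open>v\<close> without using \<open>e\<close>\<close>
  define K where "K = V \<inter> {w. (v, w) \<in> R\<^sup>*}"
  have vK: "v \<in> K" using v by (simp add: K_def)
  have "e \<inter> K \<noteq> {}"
  proof
    assume disj: "e \<inter> K = {}"
    have "f \<subseteq> K \<or> f \<inter> K = {}" if f: "f \<in> E" for f
    proof (cases "f = e")
      case True
      then show ?thesis using disj by simp
    next
      case False
      have "b \<in> K" if "a \<in> f" "a \<in> K" "b \<in> f" for a b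
      proof -
        have "(a, b) \<in> R" using f False that by (auto simp: R_def)
        moreover have "(v, a) \<in> R\<^sup>*" using that by (simp add: K_def)
        ultimately have "(v, b) \<in> R\<^sup>*" by (rule rtrancl_into_rtrancl[rotated])
        then show ?thesis using that sub[OF f] by (auto simp: K_def)
      qed
      then show ?thesis by blast
    qed
    moreover have "K \<subseteq> V" by (simp add: K_def)
    ultimately have "K = {} \<or> K = V" using con unfolding cut_connected_def by simp
    then show False using vK disj sub[OF e] edge_nonempty[OF e] by auto
  qed
  then obtain u where u: "u \<in> e" "u \<in> K" by blast
  have "S = {} \<or> S = V"
    if SV: "S \<subseteq> V" and S: "\<forall>f\<in>insert (insert v (e - {u})) (E - {e}). f \<subseteq> S \<or> f \<inter> S = {}" for S
  proof -
    have same: "w \<in> S \<longleftrightarrow> v \<in> S" if "(v, w) \<in> R\<^sup>*" for w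
      using that
    proof (induction rule: rtrancl_induct)
      case base
      then show ?case by simp
    next
      case (step a b)
      then obtain f where f: "f \<in> E - {e}" "a \<in> f" "b \<in> f" by (auto simp: R_def)
      then have "f \<subseteq> S \<or> f \<inter> S = {}" using S by simp
      then show ?case using f step.IH by auto
    qed
    have "(v, u) \<in> R\<^sup>*" using u by (simp add: K_def)
    then have "u \<in> S \<longleftrightarrow> v \<in> S" by (rule same)
    moreover have "insert v (e - {u}) \<subseteq> S \<or> insert v (e - {u}) \<inter> S = {}" using S by simp
    ultimately have "e \<subseteq> S \<or> e \<inter> S = {}" by auto
    then have "f \<subseteq> S \<or> f \<inter> S = {}" if "f \<in> E" for f
      using S that by (cases "f = e") simp_all
    then show ?thesis using con SV unfolding cut_connected_def by simp
  qed
  then have "cut_connected V (insert (insert v (e - {u})) (E - {e}))"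
    unfolding cut_connected_def by simp
  with u that show ?thesis by simp
qed

text \<open>
  The maximizer \<open>x\<close> of the old edge set gives the new one at least the same value. If the radii were
  equal, \<open>x\<close> would be a maximizer for both, and both eigenvalue equations would hold at \<open>v\<close>; but the
  new one has an additional positive term, that of the moved edge.
\<close>
lemma reattach_increases:
  assumes sys': "uniform_system r V E'"
    and E': "E' = insert e' (E - {e})" and e': "e' = insert v (e - {u})" "e' \<notin> E"
    and e: "e \<in> E" "u \<in> e" "v \<notin> e" and v: "v \<in> V"
    and mx: "is_maximizer (spectral_radius r (V, E)) x"
    and pos: "\<And>w. w \<in> V \<Longrightarrow> 0 < x w" and uv: "x u \<le> x v"
  shows "spectral_radius r (V, E) < spectral_radius r (V, E')"
proof -
  interpret new: uniform_system r V E' by (rule sys')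
  have nn: "0 \<le> x w" if "w \<in> V" for w using pos[OF that] by simp
  have eV: "e \<subseteq> V" by (rule sub[OF e(1)])
  let ?p = "\<Prod>w\<in>e - {u}. x w"
  have p: "?p > 0" using pos eV by (intro prod_pos) auto
  have pe': "(\<Prod>w\<in>e'. x w) = x v * ?p"
    using e fin_edge[OF e(1)] by (simp add: e')
  have pe: "(\<Prod>w\<in>e. x w) = x u * ?p"
    using e fin_edge[OF e(1)] by (simp add: prod.remove)
  have "edge_sum E' x = x v * ?p + edge_sum (E - {e}) x"
    using e' finE pe' by (simp add: edge_sum_def E')
  moreover have "edge_sum E x = x u * ?p + edge_sum (E - {e}) x"
    using e finE pe by (simp add: edge_sum_def sum.remove)
  ultimately have "edge_sum E x \<le> edge_sum E' x" using uv p by simp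
  then have le1: "spectral_radius r (V, E) \<le> real r * edge_sum E' x"
    using mx by (auto simp: is_maximizer_def dest: mult_left_mono[of _ _ "real r"])
  have x1: "power_sum r V x = 1" using mx by (simp add: is_maximizer_def)
  have le2: "real r * edge_sum E' x \<le> spectral_radius r (V, E')"
    using new.rayleigh[of x] nn x1 by simp
  have "spectral_radius r (V, E) \<noteq> spectral_radius r (V, E')"
  proof
    assume eq: "spectral_radius r (V, E) = spectral_radius r (V, E')"
    then have "new.is_maximizer (spectral_radius r (V, E')) x"
      using le1 le2 by (intro new.maximizerI nn x1) auto
    then have "link_sum E' x v = link_sum E x v"
      using new.maximizer_eigen[OF _ v] maximizer_eigen[OF mx v] eq by simp
    moreover have "link_sum E' x v = ?p + link_sum E x v"
    proof -
      have "{f \<in> E'. v \<in> f} = insert e' {f \<in> E. v \<in> f}" using e by (auto simp: E' e')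
      moreover have "e' - {v} = e - {u}" using e by (auto simp: e')
      ultimately show ?thesis using e' finE by (simp add: link_sum_def)
    qed
    ultimately show False using p by simp
  qed
  then show ?thesis using le1 le2 by simp
qed

end

text \<open>
  On a vertex set with \<open>1 + (r - 1) * m\<close> elements these are the edge sets of the hypertrees with \<open>m\<close>
  edges and a \<open>k\<close>-matching.
\<close>
definition admissible :: "nat \<Rightarrow> nat \<Rightarrow> nat \<Rightarrow> 'a set \<Rightarrow> 'a set set \<Rightarrow> bool" where
  "admissible r m k V E \<longleftrightarrow> uniform_system r V E \<and> cut_connected V E \<and> card E = m \<and> has_matching k (V, E)"

text \<open>
  The vertex count shows that the moved edge is a new one: otherwise \<open>m - 1\<close> edges would connect all
  vertices. In the matching, the moved edge takes the place of \<open>e\<close>; this is harmless if \<open>e\<close> is not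
  in the matching or no edge of the matching covers \<open>v\<close>.
\<close>
lemma admissible_reattach:
  assumes adm: "admissible r m k V E" and n: "card V = 1 + (r - 1) * m"
    and e: "e \<in> E" "v \<in> V" "v \<notin> e"
    and M: "M \<subseteq> E" "card M = k" "pairwise disjnt M" "e \<notin> M \<or> v \<notin> \<Union>M"
  obtains u where "u \<in> e" "insert v (e - {u}) \<notin> E"
    "admissible r m k V (insert (insert v (e - {u})) (E - {e}))"
proof -
  interpret uniform_system r V E using adm by (simp add: admissible_def)
  have con: "cut_connected V E" and m: "card E = m" using adm by (auto simp: admissible_def)
  obtain u where u: "u \<in> e" and con': "cut_connected V (insert (insert v (e - {u})) (E - {e}))"
    using reattach_connected[OF con e(1,2)] by blast
  define e' where "e' = insert v (e - {u})"
  define E' where "E' = insert e' (E - {e})"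
  have "card e' = r"
    using e u unif[OF e(1)] fin_edge[OF e(1)] r2 by (simp add: e'_def)
  moreover have "e' \<subseteq> V" using e sub[OF e(1)] by (auto simp: e'_def)
  ultimately have sys: "uniform_system r V E'"
    using fin nonempty sub unif r2 by unfold_locales (auto simp: E'_def)
  have e'E: "e' \<notin> E"
  proof
    assume "e' \<in> E"
    then have E'E: "E' = E - {e}" using e by (auto simp: E'_def e'_def)
    have "card V \<le> card {v} + (r - 1) * card (E' - {})"
      by (rule uniform_system.vertex_bound[OF sys]) (use con' e in \<open>auto simp: E'_def e'_def\<close>)
    moreover have "card E = Suc (card E')" using card_Suc_Diff1[OF finE e(1)] E'E by (simp del: card_Diff_singleton)
    ultimately show False using n m r2 by simp
  qed
  have mE': "card E' = m"
  proof -
    have "card E' = Suc (card (E - {e}))" using e'E finE by (simp add: E'_def)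
    then show ?thesis using card_Suc_Diff1[OF finE e(1)] m by (simp del: card_Diff_singleton)
  qed
  have "has_matching k (V, E')"
  proof (cases "e \<in> M")
    case False
    then have "M \<subseteq> E'" using M by (auto simp: E'_def)
    moreover have "finite M" using M finE finite_subset by blast
    ultimately show ?thesis using M unfolding has_matching_def by auto
  next
    case True
    let ?M = "insert e' (M - {e})"
    have fM: "finite M" using M finE finite_subset by blast
    have "e' \<notin> M" using e'E M by auto
    then have "card ?M = Suc (card (M - {e}))" using fM by simp
    then have "card ?M = k" using card_Suc_Diff1[OF fM True] M(2) by (simp del: card_Diff_singleton)
    moreover have "pairwise disjnt ?M"
    proof -
      have "disjnt e' f" if "f \<in> M - {e}" for f
      proof -
        have "disjnt e f" using M(3) True that by (auto simp: pairwise_def)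
        moreover have "v \<notin> f" using M(4) True that by auto
        ultimately show ?thesis by (auto simp: disjnt_def e'_def)
      qed
      moreover have "pairwise disjnt (M - {e})" using M(3) by (rule pairwise_subset) auto
      ultimately show ?thesis by (simp add: pairwise_insert disjnt_sym)
    qed
    moreover have "?M \<subseteq> E'" using M by (auto simp: E'_def)
    ultimately show ?thesis unfolding has_matching_def using fM by (intro exI[of _ ?M]) auto
  qed
  then have "admissible r m k V E'"
    using sys con' mE' by (simp add: admissible_def E'_def e'_def)
  then show ?thesis using that u e'E by (simp add: E'_def e'_def)
qed

definition extremal :: "nat \<Rightarrow> nat \<Rightarrow> nat \<Rightarrow> 'a set \<Rightarrow> 'a set set \<Rightarrow> bool" where
  "extremal r m k V E \<longleftrightarrow> admissible r m k V E \<and>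
     (\<forall>E'. admissible r m k V E' \<longrightarrow> spectral_radius r (V, E') \<le> spectral_radius r (V, E))"

lemma extremal_exists:
  assumes adm: "admissible r m k V E"
  obtains E' where "extremal r m k V E'"
proof -
  let ?C = "{E'. admissible r m k V E'}" and ?\<rho> = "\<lambda>E. spectral_radius r (V, E)"
  have "?C \<subseteq> Pow (Pow V)"
    using uniform_system.sub by (fastforce simp: admissible_def)
  moreover have "finite V" using adm uniform_system.fin by (auto simp: admissible_def)
  ultimately have "finite ?C" using finite_subset by blast
  moreover have "?C \<noteq> {}" using adm by blast
  ultimately have "Max (?\<rho> ` ?C) \<in> ?\<rho> ` ?C" by (intro Max_in) simp_all
  then obtain E' where E': "E' \<in> ?C" "?\<rho> E' = Max (?\<rho> ` ?C)" by force
  have "?\<rho> E'' \<le> ?\<rho> E'" if "E'' \<in> ?C" for E''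
    unfolding E'(2) by (rule Max_ge) (use that \<open>finite ?C\<close> in simp_all)
  then have "extremal r m k V E'" using E'(1) by (simp add: extremal_def)
  then show ?thesis by (rule that)
qed

text \<open>
  Let \<open>v\<close> be the heaviest vertex. Any edge that avoids \<open>v\<close> could be moved to \<open>v\<close>, which would increase
  the radius, unless the matching forbids it. Hence all edges that avoid \<open>v\<close> lie in the matching, and
  \<open>e0\<close> is the matching edge that covers \<open>v\<close>.
\<close>
lemma extremal_structure:
  assumes ext: "extremal r m k V E" and n: "card V = 1 + (r - 1) * m" and k: "k \<ge> 1"
  obtains v e0 where "v \<in> V" "pairwise disjnt {e \<in> E. v \<notin> e}" "card {e \<in> E. v \<notin> e} = k - 1"
    "e0 \<in> E" "v \<in> e0" "\<And>f. f \<in> E \<Longrightarrow> v \<notin> f \<Longrightarrow> disjnt e0 f"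
proof -
  have adm: "admissible r m k V E" using ext by (simp add: extremal_def)
  interpret uniform_system r V E using adm by (simp add: admissible_def)
  have con: "cut_connected V E" using adm by (auto simp: admissible_def)
  obtain M where M: "M \<subseteq> E" "finite M" "card M = k" "pairwise disjnt M"
    using adm by (auto simp: admissible_def has_matching_def)
  obtain x where mx: "is_maximizer (spectral_radius r (V, E)) x" by (rule maximizer_obtain)
  have pos: "0 < x w" if "w \<in> V" for w using maximizer_pos[OF con mx that] .
  obtain v where v: "v \<in> V" and vmax: "\<And>w. w \<in> V \<Longrightarrow> x w \<le> x v"
  proof -
    have "Max (x ` V) \<in> x ` V" using fin nonempty by (intro Max_in) auto
    then obtain v where "v \<in> V" "x v = Max (x ` V)" by auto
    then show ?thesis using that fin by (metis Max_ge finite_imageI imageI)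
  qed
  have key: "e \<in> M \<and> v \<in> \<Union>M" if e: "e \<in> E" "v \<notin> e" for e
  proof (rule ccontr)
    assume "\<not> (e \<in> M \<and> v \<in> \<Union>M)"
    then have "e \<notin> M \<or> v \<notin> \<Union>M" by blast
    then obtain u where u: "u \<in> e" "insert v (e - {u}) \<notin> E"
      and adm': "admissible r m k V (insert (insert v (e - {u})) (E - {e}))"
      using admissible_reattach[OF adm n e(1) v e(2) M(1,3,4)] by blast
    have "uniform_system r V (insert (insert v (e - {u})) (E - {e}))"
      using adm' by (simp add: admissible_def)
    then have "spectral_radius r (V, E) < spectral_radius r (V, insert (insert v (e - {u})) (E - {e}))"
      by (rule reattach_increases[OF _ refl refl u(2) e(1) u(1) e(2) v mx])
         (use pos vmax u sub[OF e(1)] in auto)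
    then show False using ext adm' by (force simp: extremal_def)
  qed
  have "M \<noteq> {}" using M k by auto
  then have "v \<in> \<Union>M" using key M(1) by blast
  then obtain e0 where e0: "e0 \<in> M" "v \<in> e0" by blast
  have uniq: "f = e0" if "f \<in> M" "v \<in> f" for f
    using M(4) e0 that by (auto simp: pairwise_def disjnt_def)
  have N: "{e \<in> E. v \<notin> e} = M - {e0}" using key uniq e0 M(1) by blast
  have "pairwise disjnt {e \<in> E. v \<notin> e}"
    unfolding N using M(4) by (rule pairwise_subset) auto
  moreover have "card {e \<in> E. v \<notin> e} = k - 1" unfolding N using M e0 by simp
  moreover have "disjnt e0 f" if "f \<in> E" "v \<notin> f" for f
    using M(4) e0 that key[OF that] by (auto simp: pairwise_def)
  ultimately show ?thesis using that v e0 M(1) by blast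
qed

section \<open>Stars with pendent edges\<close>

lemma prod_if_mem:
  fixes c :: "'b::comm_monoid_mult"
  assumes "finite A"
  shows "(\<Prod>w\<in>A. if w \<in> B then c else 1) = c ^ card (A \<inter> B)"
  using assms by (simp add: prod.If_cases Int_def)

lemma card_insert_le_Suc: "card (insert a A) \<le> Suc (card A)"
  by (cases "finite A") (simp_all add: card_insert_if)

lemma subset_singleton_Int: "f \<inter> H = {u} \<Longrightarrow> g \<subseteq> H \<Longrightarrow> f \<inter> g \<noteq> {} \<Longrightarrow> f \<inter> g = {u}"
  by auto

lemma at_most_two_terms:
  fixes \<alpha> :: real
  assumes "A = {} \<or> (\<exists>e. A = {e})" "B = {} \<or> (\<exists>f. B = {f})"
    and "A = {} \<or> H" "P \<longleftrightarrow> B \<noteq> {}" "0 \<le> \<alpha>" "\<alpha> \<le> 1"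
  shows "(\<Sum>e\<in>A. if P then 1 - \<alpha> else 1) + (\<Sum>f\<in>B. if H then \<alpha> else 1) \<le> 1"
  using assms by (elim disjE exE) auto

text \<open>
  The trees \<open>S(a\<^sub>1, \<dots>, a\<^sub>t)\<close>, described without coordinates: the edges through \<open>v\<close> are the edges of the
  star, the others turn out to be attached to them (\<open>pendents_hub\<close>).
\<close>
locale centred_tree = uniform_system r V E for r :: nat and V :: "'a set" and E +
  fixes v :: 'a
  assumes con: "cut_connected V E" and count: "card V = 1 + (r - 1) * card E"
    and centre: "v \<in> V" and disj: "pairwise disjnt {e \<in> E. v \<notin> e}"
begin

definition spokes where "spokes = {e \<in> E. v \<in> e}"
definition pendents where "pendents = {e \<in> E. v \<notin> e}"
definition hub where "hub = insert v (\<Union>spokes)"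
text \<open>
  The parameter \<open>a\<^sub>i\<close> of the star edge \<open>e\<close>.
\<close>
definition load :: "'a set \<Rightarrow> nat" where "load e = card {f \<in> pendents. f \<inter> e \<noteq> {}}"

lemma fin_spokes: "finite spokes" and fin_pendents: "finite pendents"
  using finE by (auto simp: spokes_def pendents_def)

lemma E_split: "E = spokes \<union> pendents" and spokes_pendents: "spokes \<inter> pendents = {}"
  by (auto simp: spokes_def pendents_def)

lemma card_E: "card E = card spokes + card pendents"
  using card_Un_disjoint[OF fin_spokes fin_pendents spokes_pendents] E_split by simp

text \<open>
  Two edges with two common vertices would waste a vertex in the count.
\<close>
lemma linear:
  assumes "e \<in> E" "f \<in> E" "e \<noteq> f"
  shows "card (e \<inter> f) \<le> 1"
proof -
  have two: "card {e, f} = 2" "{e, f} \<subseteq> E" using assms by auto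
  have le: "2 \<le> card E" using card_mono[OF finE two(2)] two(1) by simp
  have "card V \<le> card (e \<union> f) + (r - 1) * card (E - {e, f})"
    by (rule vertex_bound[OF con]) (use assms sub edge_nonempty in auto)
  also have "card (E - {e, f}) = card E - 2"
    using card_Diff_subset[of "{e, f}" E] two by simp
  finally have "1 + (r - 1) * card E \<le> card (e \<union> f) + (r - 1) * (card E - 2)"
    using count by simp
  moreover have "card (e \<union> f) + card (f \<inter> e) = 2 * r"
    using card_Un_edge[OF assms(2) sub[OF assms(1)]] unif[OF assms(1)] by simp
  moreover have "(r - 1) * card E = (r - 1) * (card E - 2) + 2 * (r - 1)"
    using le by (simp only: mult.commute[of 2] distrib_left[symmetric] le_add_diff_inverse2)
  ultimately show ?thesis using r2 by (simp add: Int_commute)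
qed

lemma spokes_Int:
  assumes "e \<in> spokes" "f \<in> spokes" "e \<noteq> f"
  shows "e \<inter> f = {v}"
proof -
  have ef: "e \<in> E" "f \<in> E" "v \<in> e \<inter> f" using assms by (auto simp: spokes_def)
  have "finite (e \<inter> f)" using fin_edge[OF ef(1)] by simp
  then have "\<forall>a\<in>e \<inter> f. \<forall>b\<in>e \<inter> f. a = b"
    using linear[OF ef(1,2) assms(3)] card_le_Suc0_iff_eq by (metis One_nat_def)
  then show ?thesis using ef(3) by blast
qed

lemma hub_sub: "hub \<subseteq> V"
  using sub centre by (auto simp: hub_def spokes_def)

lemma card_hub: "card hub \<le> 1 + (r - 1) * card spokes"
proof -
  have "hub = insert v (\<Union>e\<in>spokes. e - {v})" by (auto simp: hub_def)
  then have "card hub \<le> Suc (card (\<Union>e\<in>spokes. e - {v}))"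
    by (simp only: card_insert_le_Suc)
  also have "card (\<Union>e\<in>spokes. e - {v}) \<le> (\<Sum>e\<in>spokes. card (e - {v}))"
    by (rule card_UN_le[OF fin_spokes])
  also have "\<dots> = (\<Sum>e\<in>spokes. r - 1)"
    by (rule sum.cong) (use unif fin_edge in \<open>auto simp: spokes_def\<close>)
  finally show ?thesis by (simp add: mult.commute)
qed

text \<open>
  An edge \<open>f\<close> that avoids \<open>v\<close> is disjoint from the other edges of this kind, so it is an uncrossed set
  unless it meets the star. If it met the star twice, a vertex would be wasted in the count.
\<close>
lemma pendents_hub:
  assumes f: "f \<in> pendents"
  obtains u where "f \<inter> hub = {u}" "u \<noteq> v"
proof -
  have fE: "f \<in> E" and vf: "v \<notin> f" using f by (auto simp: pendents_def)
  have fi: "f \<notin> spokes" using f spokes_pendents by auto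
  have "f \<inter> hub \<noteq> {}"
  proof
    assume d: "f \<inter> hub = {}"
    have "e \<subseteq> f \<or> e \<inter> f = {}" if e: "e \<in> E" for e
    proof (cases "v \<in> e")
      case True
      then have "e \<subseteq> hub" using e by (auto simp: hub_def spokes_def)
      then show ?thesis using d by blast
    next
      case False
      then have "e = f \<or> disjnt e f" using disj e fE vf by (auto simp: pairwise_def)
      then show ?thesis by (auto simp: disjnt_def)
    qed
    then have "f = {} \<or> f = V" using con sub[OF fE] unfolding cut_connected_def by simp
    then show False using edge_nonempty[OF fE] vf centre by auto
  qed
  moreover have "card (f \<inter> hub) \<le> 1"
  proof -
    have D: "insert f spokes \<subseteq> E" "\<Union>(insert f spokes) \<subseteq> hub \<union> f"
      using fE by (auto simp: spokes_def hub_def)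
    have "card V \<le> card (hub \<union> f) + (r - 1) * card (E - insert f spokes)"
      by (rule vertex_bound[OF con _ _ D]) (use hub_sub sub[OF fE] in \<open>auto simp: hub_def\<close>)
    also have "card (E - insert f spokes) = card E - Suc (card spokes)"
      using card_Diff_subset[OF _ D(1)] fin_spokes fi by simp
    finally have "1 + (r - 1) * card E \<le> card (hub \<union> f) + (r - 1) * (card E - Suc (card spokes))"
      using count by simp
    moreover have "Suc (card spokes) \<le> card E" using card_mono[OF finE D(1)] fin_spokes fi by simp
    then have "(r - 1) * card E = (r - 1) * (card E - Suc (card spokes)) + (r - 1) * Suc (card spokes)"
      by (simp only: distrib_left[symmetric] le_add_diff_inverse2)
    ultimately have "1 + (r - 1) * Suc (card spokes) \<le> card (hub \<union> f)" by simp
    then show ?thesis using card_hub card_Un_edge[OF fE hub_sub] r2 by simp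
  qed
  ultimately obtain u where u: "f \<inter> hub = {u}"
    using fin_edge[OF fE] by (metis One_nat_def card_1_singletonE card_gt_0_iff finite_Int le_antisym Suc_leI)
  then have "u \<noteq> v" using vf by auto
  then show ?thesis using that u by blast
qed

lemma card_spokes_pendents:
  assumes "e \<in> spokes" "f \<in> pendents" "f \<inter> e \<noteq> {}"
  shows "card (e \<inter> f) = 1"
proof -
  obtain u where u: "f \<inter> hub = {u}" using pendents_hub[OF assms(2)] by blast
  have "e \<subseteq> hub" using assms by (auto simp: hub_def)
  then have "f \<inter> e = {u}" by (rule subset_singleton_Int[OF u _ assms(3)])
  then show ?thesis by (simp add: Int_commute)
qed

lemma load_eq_card:
  assumes e: "e \<in> spokes"
  shows "card (e \<inter> \<Union>pendents) = load e"
proof -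
  let ?F = "{f \<in> pendents. f \<inter> e \<noteq> {}}"
  have "e \<inter> \<Union>pendents = (\<Union>f\<in>?F. e \<inter> f)" by auto
  also have "card \<dots> = (\<Sum>f\<in>?F. card (e \<inter> f))"
  proof (rule card_UN_disjoint)
    show "finite ?F" using fin_pendents by simp
    show "\<forall>f\<in>?F. finite (e \<inter> f)" using e fin_edge by (auto simp: spokes_def)
    show "\<forall>f\<in>?F. \<forall>g\<in>?F. f \<noteq> g \<longrightarrow> (e \<inter> f) \<inter> (e \<inter> g) = {}"
      using disj by (auto simp: pairwise_def disjnt_def pendents_def)
  qed
  also have "\<dots> = (\<Sum>f\<in>?F. 1)" using card_spokes_pendents[OF e] by (intro sum.cong) auto
  finally show ?thesis by (simp add: load_def)
qed

lemma load_le: assumes "e \<in> spokes" shows "load e \<le> r - 1"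
proof -
  have e: "e \<in> E" "v \<in> e" using assms by (auto simp: spokes_def)
  have "e \<inter> \<Union>pendents \<subseteq> e - {v}" by (auto simp: pendents_def)
  then have "card (e \<inter> \<Union>pendents) \<le> card (e - {v})"
    using fin_edge[OF e(1)] by (intro card_mono) auto
  then show ?thesis using load_eq_card[OF assms] e unif[OF e(1)] fin_edge[OF e(1)] by simp
qed

lemma pendents_spokes_unique:
  assumes f: "f \<in> pendents"
  shows "card {e \<in> spokes. f \<inter> e \<noteq> {}} = 1"
proof -
  obtain u where u: "f \<inter> hub = {u}" "u \<noteq> v" using pendents_hub[OF f] by blast
  then have uh: "u \<in> f" "u \<in> hub" by auto
  then obtain e where e: "e \<in> spokes" "u \<in> e" using u(2) by (auto simp: hub_def)
  have "g = e" if g: "g \<in> spokes" "f \<inter> g \<noteq> {}" for g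
  proof (rule ccontr)
    assume ne: "g \<noteq> e"
    have "g \<subseteq> hub" using g by (auto simp: hub_def)
    then have "f \<inter> g = {u}" by (rule subset_singleton_Int[OF u(1) _ g(2)])
    then have "u \<in> g" by auto
    then show False using spokes_Int[OF g(1) e(1) ne] e(2) u(2) by blast
  qed
  then have "{e \<in> spokes. f \<inter> e \<noteq> {}} = {e}" using e uh by blast
  then show ?thesis by simp
qed

lemma sum_load: "(\<Sum>e\<in>spokes. load e) = card pendents"
proof -
  have "(\<Sum>e\<in>spokes. load e) = (\<Sum>e\<in>spokes. \<Sum>f | f \<in> pendents \<and> f \<inter> e \<noteq> {}. 1)"
    by (simp add: load_def)
  also have "\<dots> = (\<Sum>f\<in>pendents. \<Sum>e | e \<in> spokes \<and> f \<inter> e \<noteq> {}. 1)"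
    by (rule sum.swap_restrict[OF fin_spokes fin_pendents])
  also have "\<dots> = (\<Sum>f\<in>pendents. 1)" using pendents_spokes_unique by (intro sum.cong) auto
  finally show ?thesis by simp
qed

lemma pendents_unique: "f \<in> pendents \<Longrightarrow> g \<in> pendents \<Longrightarrow> w \<in> f \<Longrightarrow> w \<in> g \<Longrightarrow> f = g"
  using disj by (auto simp: pairwise_def disjnt_def pendents_def)

text \<open>
  On a pendent edge: \<open>\<alpha>\<close> at its attachment vertex and \<open>1\<close> elsewhere. On a star edge: \<open>1 - \<alpha>\<close> where
  a pendent edge is attached, \<open>1\<close> at the other noncentral vertices, and at \<open>v\<close> whatever makes the
  product equal to \<open>\<alpha>\<close>.
\<close>
definition weight :: "real \<Rightarrow> 'a \<Rightarrow> 'a set \<Rightarrow> real" where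
  "weight \<alpha> w e =
     (if v \<in> e then if w = v then \<alpha> * (1 / (1 - \<alpha>)) ^ load e else if w \<in> \<Union>pendents then 1 - \<alpha> else 1
      else if w \<in> hub then \<alpha> else 1)"

text \<open>
  If \<open>\<alpha> = 1\<close>, division by \<open>1 - \<alpha>\<close> is meaningless, but without pendent edges all loads are \<open>0\<close> and
  the power of the quotient is \<open>1\<close>.
\<close>
lemma weight_prod:
  assumes \<alpha>: "0 < \<alpha>" "\<alpha> < 1 \<or> pendents = {}" and e: "e \<in> E"
  shows "(\<Prod>w\<in>e. weight \<alpha> w e) = \<alpha>"
proof (cases "v \<in> e")
  case True
  then have ei: "e \<in> spokes" using e by (simp add: spokes_def)
  have "(\<Prod>w\<in>e - {v}. weight \<alpha> w e) = (\<Prod>w\<in>e - {v}. if w \<in> \<Union>pendents then 1 - \<alpha> else 1)"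
    by (rule prod.cong) (use True in \<open>auto simp: weight_def\<close>)
  also have "\<dots> = (1 - \<alpha>) ^ card ((e - {v}) \<inter> \<Union>pendents)"
    by (rule prod_if_mem) (use fin_edge[OF e] in simp)
  also have "(e - {v}) \<inter> \<Union>pendents = e \<inter> \<Union>pendents" by (auto simp: pendents_def)
  finally have p: "(\<Prod>w\<in>e - {v}. weight \<alpha> w e) = (1 - \<alpha>) ^ load e" using load_eq_card[OF ei] by simp
  have "(1 / (1 - \<alpha>)) ^ load e * (1 - \<alpha>) ^ load e = 1"
  proof (cases "pendents = {}")
    case True
    then show ?thesis by (simp add: load_def)
  next
    case False
    then show ?thesis using \<alpha> by (simp flip: power_mult_distrib)
  qed
  moreover have "weight \<alpha> v e = \<alpha> * (1 / (1 - \<alpha>)) ^ load e" using True by (simp add: weight_def)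
  ultimately show ?thesis
    using prod.remove[OF fin_edge[OF e] True, of "\<lambda>w. weight \<alpha> w e"] p by (simp add: mult.assoc)
next
  case False
  then have "e \<in> pendents" using e by (simp add: pendents_def)
  then obtain u where u: "e \<inter> hub = {u}" using pendents_hub by blast
  have "(\<Prod>w\<in>e. weight \<alpha> w e) = (\<Prod>w\<in>e. if w \<in> hub then \<alpha> else 1)"
    by (rule prod.cong) (use False in \<open>auto simp: weight_def\<close>)
  then show ?thesis using prod_if_mem[OF fin_edge[OF e], of hub \<alpha>] u by simp
qed

lemma weight_sum_centre:
  "(\<Sum>e | e \<in> E \<and> v \<in> e. weight \<alpha> v e) = (\<Sum>e\<in>spokes. \<alpha> * (1 / (1 - \<alpha>)) ^ load e)"
  by (rule sum.cong) (auto simp: spokes_def weight_def)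

lemma weight_sum_le:
  assumes \<alpha>: "0 < \<alpha>" "\<alpha> \<le> 1" and w: "w \<noteq> v"
  shows "(\<Sum>e | e \<in> E \<and> w \<in> e. weight \<alpha> w e) \<le> 1"
proof -
  let ?I = "{e \<in> spokes. w \<in> e}" and ?O = "{f \<in> pendents. w \<in> f}"
  have I: "?I = {} \<or> (\<exists>e. ?I = {e})"
  proof (cases "?I = {}")
    case False
    then obtain e where e: "e \<in> ?I" by blast
    have "f = e" if "f \<in> ?I" for f
    proof (rule ccontr)
      assume "f \<noteq> e"
      then have "f \<inter> e = {v}" using spokes_Int[of f e] that e by simp
      then show False using that e w by blast
    qed
    then show ?thesis using e by blast
  qed simp
  have O: "?O = {} \<or> (\<exists>f. ?O = {f})"
  proof (cases "?O = {}")
    case False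
    then obtain f where f: "f \<in> ?O" by blast
    then have "?O = {f}" using pendents_unique by blast
    then show ?thesis by blast
  qed simp
  have split: "{e. e \<in> E \<and> w \<in> e} = ?I \<union> ?O" using E_split by auto
  have "(\<Sum>e | e \<in> E \<and> w \<in> e. weight \<alpha> w e) = (\<Sum>e\<in>?I. weight \<alpha> w e) + (\<Sum>f\<in>?O. weight \<alpha> w f)"
    unfolding split by (rule sum.union_disjoint) (use fin_spokes fin_pendents spokes_pendents in auto)
  also have "(\<Sum>e\<in>?I. weight \<alpha> w e) = (\<Sum>e\<in>?I. if w \<in> \<Union>pendents then 1 - \<alpha> else 1)"
    by (rule sum.cong) (use w in \<open>auto simp: weight_def spokes_def\<close>)
  also have "(\<Sum>f\<in>?O. weight \<alpha> w f) = (\<Sum>f\<in>?O. if w \<in> hub then \<alpha> else 1)"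
    by (rule sum.cong) (auto simp: weight_def pendents_def)
  also have "(\<Sum>e\<in>?I. if w \<in> \<Union>pendents then 1 - \<alpha> else 1) + (\<Sum>f\<in>?O. if w \<in> hub then \<alpha> else 1) \<le> 1"
  proof (rule at_most_two_terms[OF I O])
    show "?I = {} \<or> w \<in> hub" by (auto simp: hub_def)
    show "w \<in> \<Union>pendents \<longleftrightarrow> ?O \<noteq> {}" by auto
  qed (use \<alpha> in simp_all)
  finally show ?thesis .
qed

text \<open>
  At all vertices but \<open>v\<close> the labels add up to at most \<open>1\<close>, so only the sum at \<open>v\<close> matters. Strictness
  there survives because the maximizer is positive at \<open>v\<close>.
\<close>
lemma radius_bound:
  assumes \<alpha>: "0 < \<alpha>" "\<alpha> \<le> 1" "\<alpha> < 1 \<or> pendents = {}"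
    and W: "(\<Sum>e\<in>spokes. \<alpha> * (1 / (1 - \<alpha>)) ^ load e) \<le> 1"
  shows "\<alpha> powr (1 / r) * spectral_radius r (V, E) \<le> 1"
    and "(\<Sum>e\<in>spokes. \<alpha> * (1 / (1 - \<alpha>)) ^ load e) < 1
           \<Longrightarrow> \<alpha> powr (1 / r) * spectral_radius r (V, E) < 1"
proof -
  let ?W = "\<Sum>e\<in>spokes. \<alpha> * (1 / (1 - \<alpha>)) ^ load e"
  obtain x where mx: "is_maximizer (spectral_radius r (V, E)) x" by (rule maximizer_obtain)
  have pos: "0 < x w" if "w \<in> V" for w using maximizer_pos[OF con mx that] .
  have x1: "power_sum r V x = 1" and xr: "real r * edge_sum E x = spectral_radius r (V, E)"
    using mx by (auto simp: is_maximizer_def)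
  have "\<alpha> powr (1 / r) * (real r * edge_sum E x)
      \<le> (\<Sum>w\<in>V. (\<Sum>e | e \<in> E \<and> w \<in> e. weight \<alpha> w e) * x w ^ r)"
  proof (rule labelling_bound)
    show "0 \<le> weight \<alpha> w e" for e w using \<alpha> by (simp add: weight_def)
    show "0 \<le> x w" if "w \<in> V" for w using pos[OF that] by simp
  qed (rule weight_prod[OF \<alpha>(1,3)])
  also have "\<dots> = ?W * x v ^ r + (\<Sum>w\<in>V - {v}. (\<Sum>e | e \<in> E \<and> w \<in> e. weight \<alpha> w e) * x w ^ r)"
    by (simp add: sum.remove[OF fin centre] weight_sum_centre)
  also have "\<dots> \<le> ?W * x v ^ r + (\<Sum>w\<in>V - {v}. 1 * x w ^ r)"
  proof (intro add_left_mono sum_mono mult_right_mono)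
    fix w assume w: "w \<in> V - {v}"
    then show "(\<Sum>e | e \<in> E \<and> w \<in> e. weight \<alpha> w e) \<le> 1" by (intro weight_sum_le \<alpha>) auto
    show "0 \<le> x w ^ r" using pos[of w] w by simp
  qed
  also have "(\<Sum>w\<in>V - {v}. 1 * x w ^ r) = 1 - x v ^ r"
    using x1 sum.remove[OF fin centre, of "\<lambda>w. x w ^ r"] by (simp add: power_sum_def)
  finally have le: "\<alpha> powr (1 / r) * spectral_radius r (V, E) \<le> 1 + (?W - 1) * x v ^ r"
    unfolding xr by (simp add: algebra_simps)
  have xv: "x v ^ r > 0" using pos[OF centre] by simp
  have "(?W - 1) * x v ^ r \<le> 0" using W xv by (simp add: mult_nonpos_nonneg)
  then show "\<alpha> powr (1 / r) * spectral_radius r (V, E) \<le> 1" using le by linarith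
  assume "?W < 1"
  then have "(?W - 1) * x v ^ r < 0" using xv by (simp add: mult_neg_pos)
  then show "\<alpha> powr (1 / r) * spectral_radius r (V, E) < 1" using le by linarith
qed

end

section \<open>Convexity concentrates the loads\<close>

text \<open>
  The largest value of \<open>\<Sum>\<^sub>i (y ^ a\<^sub>i - 1)\<close> over all families of loads \<open>a\<^sub>i \<le> R\<close> with sum \<open>n\<close>: as many loads as possible
  are equal to \<open>R\<close>, and one takes the remainder.
\<close>
definition excess :: "nat \<Rightarrow> real \<Rightarrow> nat \<Rightarrow> real" where
  "excess R y n = real (n div R) * (y ^ R - 1) + (y ^ (n mod R) - 1)"

lemma div_mod_add: "t < R \<Longrightarrow> (R * q + t) div R = q" "t < R \<Longrightarrow> (R * q + t) mod R = t" for R :: nat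
  by simp_all

lemma excess_add: "t < R \<Longrightarrow> excess R y (R * q + t) = real q * (y ^ R - 1) + (y ^ t - 1)"
  by (simp only: excess_def div_mod_add)

text \<open>
  Let \<open>s\<close> be the remainder of \<open>n\<close> modulo \<open>R\<close>. Adding \<open>a\<close> either stays below the next multiple of
  \<open>R\<close>, and the difference of the two sides is \<open>(y ^ s - 1) (y ^ a - 1)\<close>, or it passes to the remainder
  \<open>t = s + a - R < a\<close>, and the difference is \<open>(y ^ a - y ^ t) (y ^ (R - a) - 1)\<close>.
\<close>
lemma excess_step:
  fixes y :: real
  assumes y: "y > 1" and R: "R > 0" and a: "a \<le> R"
  shows "y ^ a - 1 + excess R y n \<le> excess R y (n + a)"
    and "y ^ a - 1 + excess R y n = excess R y (n + a) \<Longrightarrow> a = 0 \<or> a = R \<or> R dvd n"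
proof -
  obtain q s where n: "n = R * q + s" and s: "s < R"
    using R by (metis mult_div_mod_eq mod_less_divisor)
  have ex: "excess R y n = real q * (y ^ R - 1) + (y ^ s - 1)"
    unfolding n by (rule excess_add[OF s])
  have "y ^ a - 1 + excess R y n \<le> excess R y (n + a) \<and>
    (y ^ a - 1 + excess R y n = excess R y (n + a) \<longrightarrow> a = 0 \<or> a = R \<or> R dvd n)"
  proof (cases "s + a < R")
    case True
    have "excess R y (n + a) = real q * (y ^ R - 1) + (y ^ (s + a) - 1)"
      unfolding n add.assoc by (rule excess_add[OF True])
    then have id: "excess R y (n + a) - (y ^ a - 1 + excess R y n) = (y ^ s - 1) * (y ^ a - 1)"
      unfolding ex by (simp add: power_add algebra_simps)
    have "y ^ s - 1 \<ge> 0" "y ^ a - 1 \<ge> 0" using y by simp_all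
    then have "(y ^ s - 1) * (y ^ a - 1) \<ge> 0" by simp
    moreover have "s = 0 \<or> a = 0" if "(y ^ s - 1) * (y ^ a - 1) = 0"
    proof (rule ccontr)
      assume "\<not> (s = 0 \<or> a = 0)"
      then have "y ^ s > 1" "y ^ a > 1" using one_less_power[OF y] by simp_all
      then show False using that by simp
    qed
    moreover have "R dvd n" if "s = 0" using that n by simp
    ultimately show ?thesis using id by auto
  next
    case False
    define t where "t = s + a - R"
    define d where "d = R - a"
    have sd: "s = t + d" and Rd: "R = a + d" and ta: "t < a"
      using False a s by (auto simp: t_def d_def)
    have na: "n + a = R * Suc q + t" using n False by (simp add: t_def)
    have tR: "t < R" using ta a by simp
    have "excess R y (n + a) = real (Suc q) * (y ^ R - 1) + (y ^ t - 1)"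
      unfolding na by (rule excess_add[OF tR])
    then have "excess R y (n + a) - (y ^ a - 1 + excess R y n)
        = (y ^ R - 1) + y ^ t - y ^ s - (y ^ a - 1)"
      unfolding ex by (simp add: algebra_simps)
    also have "\<dots> = (y ^ a - y ^ t) * (y ^ d - 1)"
      unfolding sd Rd by (simp add: power_add algebra_simps)
    finally have id: "excess R y (n + a) - (y ^ a - 1 + excess R y n) = (y ^ a - y ^ t) * (y ^ d - 1)" .
    have p: "y ^ a - y ^ t > 0" using power_strict_increasing[OF ta y] by simp
    have "y ^ d - 1 \<ge> 0" using y by simp
    then have "(y ^ a - y ^ t) * (y ^ d - 1) \<ge> 0" using p by simp
    moreover have "d = 0" if "(y ^ a - y ^ t) * (y ^ d - 1) = 0"
    proof (rule ccontr)
      assume "d \<noteq> 0"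
      then have "y ^ d > 1" using one_less_power[OF y] by simp
      then show False using that p by simp
    qed
    ultimately show ?thesis using id Rd by auto
  qed
  then show "y ^ a - 1 + excess R y n \<le> excess R y (n + a)"
    and "y ^ a - 1 + excess R y n = excess R y (n + a) \<Longrightarrow> a = 0 \<or> a = R \<or> R dvd n" by auto
qed

text \<open>
  Induction over the index set, adding one load at a time. In the case of equality, a load strictly
  between \<open>0\<close> and \<open>R\<close> can only be added to loads whose sum is divisible by \<open>R\<close>. As at most one of
  those lies strictly between \<open>0\<close> and \<open>R\<close>, none does. So at most one load ever does.
\<close>
lemma sum_excess:
  fixes y :: real and a :: "'i \<Rightarrow> nat"
  assumes y: "y > 1" and R: "R > 0" and I: "finite I"
  shows "\<forall>i\<in>I. a i \<le> R \<Longrightarrow>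
     (\<Sum>i\<in>I. y ^ a i - 1) \<le> excess R y (\<Sum>i\<in>I. a i) \<and>
     ((\<Sum>i\<in>I. y ^ a i - 1) = excess R y (\<Sum>i\<in>I. a i) \<longrightarrow>
        (\<forall>i\<in>I. \<forall>j\<in>I. 0 < a i \<longrightarrow> a i < R \<longrightarrow> 0 < a j \<longrightarrow> a j < R \<longrightarrow> i = j))"
  using I
proof (induction I rule: finite_induct)
  case empty
  then show ?case by (simp add: excess_def)
next
  case (insert i I)
  let ?n = "\<Sum>j\<in>I. a j" and ?P = "\<Sum>j\<in>I. y ^ a j - 1"
  have IH1: "?P \<le> excess R y ?n"
    and IH2: "?P = excess R y ?n \<Longrightarrow>
       \<forall>i\<in>I. \<forall>j\<in>I. 0 < a i \<longrightarrow> a i < R \<longrightarrow> 0 < a j \<longrightarrow> a j < R \<longrightarrow> i = j"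
    using insert by auto
  have ai: "a i \<le> R" using insert by simp
  have step: "y ^ a i - 1 + excess R y ?n \<le> excess R y (?n + a i)"
    by (rule excess_step(1)[OF y R ai])
  have sums: "(\<Sum>j\<in>insert i I. a j) = ?n + a i" "(\<Sum>j\<in>insert i I. y ^ a j - 1) = y ^ a i - 1 + ?P"
    using insert.hyps by simp_all
  have "\<forall>j\<in>insert i I. \<forall>k\<in>insert i I. 0 < a j \<longrightarrow> a j < R \<longrightarrow> 0 < a k \<longrightarrow> a k < R \<longrightarrow> j = k"
    if eq: "(\<Sum>j\<in>insert i I. y ^ a j - 1) = excess R y (\<Sum>j\<in>insert i I. a j)"
  proof -
    have e1: "?P = excess R y ?n" and e2: "y ^ a i - 1 + excess R y ?n = excess R y (?n + a i)"
      using eq IH1 step unfolding sums by linarith+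
    note I = IH2[OF e1]
    have d: "a i = 0 \<or> a i = R \<or> R dvd ?n" by (rule excess_step(2)[OF y R ai e2])
    have noI: "\<not> (0 < a j \<and> a j < R)" if "R dvd ?n" "j \<in> I" for j
    proof
      assume j: "0 < a j \<and> a j < R"
      have "R dvd (\<Sum>k\<in>I - {j}. a k)"
      proof (rule dvd_sum)
        fix k assume k: "k \<in> I - {j}"
        then have "\<not> (0 < a k \<and> a k < R)" using I j that by auto
        then have "a k = 0 \<or> a k = R" using insert.prems k by force
        then show "R dvd a k" by auto
      qed
      moreover have "?n = a j + (\<Sum>k\<in>I - {j}. a k)"
        using insert.hyps that by (simp add: sum.remove)
      ultimately have "R dvd a j" using that by (metis dvd_add_left_iff)
      then show False using j by (auto dest: dvd_imp_le)
    qed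
    show ?thesis
    proof (cases "0 < a i \<and> a i < R")
      case True
      then have "R dvd ?n" using d by auto
      then show ?thesis using noI by blast
    next
      case False
      then show ?thesis using I by blast
    qed
  qed
  then show ?case using IH1 step unfolding sums by auto
qed

text \<open>
  Once all loads but that of \<open>j\<close> are \<open>0\<close> or \<open>R\<close>, division with remainder determines how many are \<open>R\<close>
  and the load of \<open>j\<close>.
\<close>
lemma enumerate_extremal_loads:
  fixes a :: "'i \<Rightarrow> nat"
  assumes I: "finite I" and j: "j \<in> I" "a j < R" and others: "\<forall>i\<in>I - {j}. a i = 0 \<or> a i = R"
    and card: "card I = q + 1 + l" and tot: "(\<Sum>i\<in>I. a i) = R * q + s" and s: "s < R"
  obtains es where "distinct es" "set es = I" "map a es = replicate q R @ [s] @ replicate l 0"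
proof -
  let ?X = "{i \<in> I - {j}. a i = R}" and ?Z = "{i \<in> I - {j}. a i = 0}"
  have R: "R > 0" using s by simp
  have XZ: "I - {j} = ?X \<union> ?Z" using others by blast
  have XZ0: "?X \<inter> ?Z = {}" using R by auto
  have fin: "finite ?X" "finite ?Z" using I by auto
  have "(\<Sum>i\<in>I - {j}. a i) = (\<Sum>i\<in>?X. a i) + (\<Sum>i\<in>?Z. a i)"
    by (subst XZ, rule sum.union_disjoint[OF fin XZ0])
  then have "(\<Sum>i\<in>I - {j}. a i) = R * card ?X" by (simp add: mult.commute)
  then have eq: "R * card ?X + a j = R * q + s"
    using tot sum.remove[OF I j(1), of a] by simp
  have q: "card ?X = q"
    using arg_cong[OF eq, of "\<lambda>n. n div R"] by (simp only: div_mod_add[OF j(2)] div_mod_add[OF s])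
  then have aj: "a j = s" using eq by simp
  have "card (I - {j}) = card ?X + card ?Z"
    by (subst XZ, rule card_Un_disjoint[OF fin XZ0])
  then have l: "card ?Z = l" using q card I j by simp
  obtain xs where xs: "set xs = ?X" "distinct xs" using finite_distinct_list[OF fin(1)] by blast
  obtain zs where zs: "set zs = ?Z" "distinct zs" using finite_distinct_list[OF fin(2)] by blast
  have "map a xs = replicate q R"
    by (rule replicate_eqI) (use xs q distinct_card[OF xs(2)] in auto)
  moreover have "map a zs = replicate l 0"
    by (rule replicate_eqI) (use zs l distinct_card[OF zs(2)] in auto)
  moreover have "distinct (xs @ [j] @ zs)" using xs zs R by auto
  moreover have "set (xs @ [j] @ zs) = I"
  proof -
    have "set (xs @ [j] @ zs) = ?X \<union> insert j ?Z" by (simp only: set_append list.set xs(1) zs(1) Un_insert_left Un_empty_left)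
    also have "\<dots> = I" using others j(1) by blast
    finally show ?thesis .
  qed
  ultimately show ?thesis using that[of "xs @ [j] @ zs"] aj by simp
qed

text \<open>
  The claim for \<open>y > 1\<close> is \<open>sum_excess\<close> with \<open>1\<close> added for every index. The alternative covers the
  root \<open>0\<close>, where \<open>y\<close> is the quotient \<open>1 / 0\<close>; then all powers are \<open>1\<close> and both sides count the indices.
\<close>
lemma load_sum_extremal:
  fixes a :: "'i \<Rightarrow> nat" and y :: real
  assumes I: "finite I" and aR: "\<And>i. i \<in> I \<Longrightarrow> a i \<le> R"
    and card: "card I = q + 1 + l" and tot: "(\<Sum>i\<in>I. a i) = R * q + s" and s: "s < R"
    and y: "y > 1 \<or> (\<forall>i\<in>I. a i = 0)"
  shows "(\<Sum>i\<in>I. y ^ a i) \<le> q * y ^ R + y ^ s + l"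
    and "(\<Sum>i\<in>I. y ^ a i) = q * y ^ R + y ^ s + l \<Longrightarrow>
           \<exists>es. distinct es \<and> set es = I \<and> map a es = replicate q R @ [s] @ replicate l 0"
proof -
  have R: "R > 0" using s by simp
  have ne: "I \<noteq> {}" using card by auto
  have list: "\<exists>es. distinct es \<and> set es = I \<and> map a es = replicate q R @ [s] @ replicate l 0"
    if one: "\<forall>i\<in>I. \<forall>j\<in>I. 0 < a i \<longrightarrow> a i < R \<longrightarrow> 0 < a j \<longrightarrow> a j < R \<longrightarrow> i = j"
  proof -
    obtain j where j: "j \<in> I" "a j < R" and others: "\<forall>i\<in>I - {j}. a i = 0 \<or> a i = R"
    proof (cases "\<exists>j\<in>I. 0 < a j \<and> a j < R")
      case True
      then obtain j where j: "j \<in> I" "0 < a j" "a j < R" by blast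
      have "a i = 0 \<or> a i = R" if "i \<in> I - {j}" for i
      proof -
        have "\<not> (0 < a i \<and> a i < R)" using one that j by blast
        then show ?thesis using aR[of i] that by auto
      qed
      then show ?thesis using that j by blast
    next
      case False
      have all: "a i = 0 \<or> a i = R" if "i \<in> I" for i using False aR[OF that] that by force
      have "\<exists>j\<in>I. a j \<noteq> R"
      proof (rule ccontr)
        assume "\<not> (\<exists>j\<in>I. a j \<noteq> R)"
        then have "(\<Sum>i\<in>I. a i) = (\<Sum>i\<in>I. R)" by (intro sum.cong) auto
        then have "R * q + s = (q + 1 + l) * R" using card tot by simp
        then show False using s by (simp add: algebra_simps)
      qed
      then obtain j where "j \<in> I" "a j = 0" using all by blast
      then show ?thesis using that[of j] all R by simp
    qed
    then show ?thesis using enumerate_extremal_loads[OF I j others card tot s] by blast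
  qed
  have sumy: "(\<Sum>i\<in>I. y ^ a i) = (\<Sum>i\<in>I. y ^ a i - 1) + q + 1 + l"
    using card by (simp add: sum_subtractf)
  have "(\<Sum>i\<in>I. y ^ a i) \<le> q * y ^ R + y ^ s + l \<and>
    ((\<Sum>i\<in>I. y ^ a i) = q * y ^ R + y ^ s + l \<longrightarrow>
       (\<exists>es. distinct es \<and> set es = I \<and> map a es = replicate q R @ [s] @ replicate l 0))"
  proof (cases "y > 1")
    case True
    have "real q * (y ^ R - 1) + (y ^ s - 1) = excess R y (\<Sum>i\<in>I. a i)"
      unfolding tot by (rule excess_add[OF s, symmetric])
    then show ?thesis
      using sum_excess[OF True R I, of a] aR list unfolding sumy by (auto simp: algebra_simps)
  next
    case False
    then have a0: "\<forall>i\<in>I. a i = 0" using y by simp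
    then have "R * q + s = 0" using tot by simp
    then have "q = 0" "s = 0" using R by auto
    moreover have "(\<Sum>i\<in>I. y ^ a i) = card I" using a0 by simp
    moreover have "\<exists>es. distinct es \<and> set es = I \<and> map a es = replicate q R @ [s] @ replicate l 0"
      using a0 by (intro list) auto
    ultimately show ?thesis using card by simp
  qed
  then show "(\<Sum>i\<in>I. y ^ a i) \<le> q * y ^ R + y ^ s + l"
    and "(\<Sum>i\<in>I. y ^ a i) = q * y ^ R + y ^ s + l \<Longrightarrow>
           \<exists>es. distinct es \<and> set es = I \<and> map a es = replicate q R @ [s] @ replicate l 0" by auto
qed

section \<open>Recognizing stars with pendent edges\<close>

definition pendent_places :: "nat list \<Rightarrow> (nat \<times> nat) set" where
  "pendent_places as = (SIGMA i:{..<length as}. {..<as ! i})"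

lemma finite_pendent_places: "finite (pendent_places as)"
  by (simp add: pendent_places_def)

lemma edges_S_hypertree:
  "edges (S_hypertree r as) =
     star_edge r ` {..<length as} \<union> (\<lambda>(i, j). attached_edge r i j) ` pendent_places as"
  by (auto simp: S_hypertree_def hyperstar_def pendent_places_def Let_def)

lemma verts_S_hypertree:
  assumes "\<forall>a\<in>set as. a \<le> r - 1"
  shows "verts (S_hypertree r as) = insert Center
     ((\<lambda>(i, j). Star_Vertex i j) ` ({..<length as} \<times> {..<r - 1})
      \<union> (\<lambda>((i, j), p). Pendent_Vertex i j p) ` (pendent_places as \<times> {..<r - 1}))"
proof -
  have "j < r - 1" if "i < length as" "j < as ! i" for i j
    using assms that nth_mem[OF that(1)] by fastforce
  then show ?thesis
    unfolding S_hypertree_def hyperstar_def pendent_places_def Let_def star_edge_def attached_edge_def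
    by (auto simp: image_iff) blast+
qed

lemma image_insert_Collect: "g ` insert c {h j | j. P j} = insert (g c) {g (h j) | j. P j}"
  by blast

lemma hypergraph_iso_sym:
  assumes iso: "hypergraph_iso G H" and G: "edges G \<subseteq> Pow (verts G)"
  shows "hypergraph_iso H G"
proof -
  obtain f where f: "bij_betw f (verts G) (verts H)" "(\<lambda>e. f ` e) ` edges G = edges H"
    using iso by (auto simp: hypergraph_iso_def)
  let ?g = "inv_into (verts G) f"
  have inj: "inj_on f (verts G)" using f(1) by (simp add: bij_betw_def)
  have "?g ` f ` e = e" if "e \<in> edges G" for e
    using inv_into_image_cancel[OF inj] that G by auto
  then have "(\<lambda>e. ?g ` e) ` edges H = edges G"
    unfolding f(2)[symmetric] image_image by simp
  then show ?thesis using bij_betw_inv_into[OF f(1)] by (auto simp: hypergraph_iso_def)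
qed

context centred_tree
begin

text \<open>
  List the attachment vertices of a star edge first, as the definition of \<open>S_hypertree\<close> does.
\<close>
lemma spoke_enumeration:
  assumes e: "e \<in> spokes"
  shows "\<exists>us. set us = e - {v} \<and> length us = r - 1 \<and>
           (\<forall>j<r - 1. us ! j \<in> \<Union>pendents \<longleftrightarrow> j < load e)"
proof -
  have eE: "e \<in> E" "v \<in> e" using e by (auto simp: spokes_def)
  have vn: "v \<notin> \<Union>pendents" by (auto simp: pendents_def)
  obtain xs where xs: "set xs = e \<inter> \<Union>pendents" "distinct xs"
    using finite_distinct_list[of "e \<inter> \<Union>pendents"] fin_edge[OF eE(1)] by auto
  obtain ys where ys: "set ys = e - {v} - \<Union>pendents" "distinct ys"
    using finite_distinct_list[of "e - {v} - \<Union>pendents"] fin_edge[OF eE(1)] by auto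
  have lx: "length xs = load e" using distinct_card[OF xs(2)] load_eq_card[OF e] xs(1) by simp
  have st: "set (xs @ ys) = e - {v}" using xs ys vn by auto
  have "distinct (xs @ ys)" using xs ys by auto
  then have "length (xs @ ys) = card (e - {v})" using distinct_card st by metis
  then have len: "length (xs @ ys) = r - 1" using eE unif[OF eE(1)] fin_edge[OF eE(1)] by simp
  have "(xs @ ys) ! j \<in> \<Union>pendents \<longleftrightarrow> j < load e" if j: "j < r - 1" for j
  proof (cases "j < length xs")
    case True
    then show ?thesis using nth_mem[OF True] xs lx by (simp add: nth_append)
  next
    case False
    then have "ys ! (j - length xs) \<in> set ys" using j len by (intro nth_mem) simp
    then show ?thesis using False ys lx by (simp add: nth_append)
  qed
  then show ?thesis using st len by blast
qed

text \<open>
  The map \<open>g\<close> sends the coordinates to the enumerated vertices and covers all edges. Both sides have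
  the same number of vertices, so surjectivity of \<open>g\<close> already makes it bijective.
\<close>
lemma iso_S_hypertree:
  assumes es: "distinct es" "set es = spokes"
  shows "hypergraph_iso (V, E) (S_hypertree r (map load es))"
proof -
  let ?as = "map load es" and ?t = "length es"
  let ?H = "S_hypertree r ?as"
  have esi: "es ! i \<in> spokes" if "i < ?t" for i using nth_mem[OF that] es(2) by simp
  have "\<exists>us. \<forall>e\<in>spokes. set (us e) = e - {v} \<and> length (us e) = r - 1 \<and>
           (\<forall>j<r - 1. us e ! j \<in> \<Union>pendents \<longleftrightarrow> j < load e)"
    by (rule bchoice, rule ballI, rule spoke_enumeration)
  then obtain us where U: "\<forall>e\<in>spokes. set (us e) = e - {v} \<and> length (us e) = r - 1 \<and>
           (\<forall>j<r - 1. us e ! j \<in> \<Union>pendents \<longleftrightarrow> j < load e)" by (rule exE)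
  have us: "set (us e) = e - {v}" "length (us e) = r - 1" if "e \<in> spokes" for e
    using bspec[OF U that] by simp_all
  have us3: "us e ! j \<in> \<Union>pendents \<longleftrightarrow> j < load e" if "e \<in> spokes" "j < r - 1" for e j
    using bspec[OF U that(1)] that(2) by blast
  have "\<exists>f ws. f \<in> pendents \<and> u \<in> f \<and> set ws = f - {u} \<and> length ws = r - 1"
    if u: "u \<in> \<Union>pendents" for u
  proof -
    obtain f where f: "f \<in> pendents" "u \<in> f" using u by blast
    then have fE: "f \<in> E" by (simp add: pendents_def)
    obtain ws where ws: "set ws = f - {u}" "distinct ws"
      using finite_distinct_list[of "f - {u}"] fin_edge[OF fE] by auto
    then have "length ws = r - 1" using distinct_card[OF ws(2)] f unif[OF fE] fin_edge[OF fE] by simp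
    then show ?thesis using f ws by blast
  qed
  then have "\<forall>u\<in>\<Union>pendents. \<exists>p. fst p \<in> pendents \<and> u \<in> fst p \<and>
      set (snd p) = fst p - {u} \<and> length (snd p) = r - 1" by fastforce
  then have "\<exists>P. \<forall>u\<in>\<Union>pendents. fst (P u) \<in> pendents \<and> u \<in> fst (P u) \<and>
      set (snd (P u)) = fst (P u) - {u} \<and> length (snd (P u)) = r - 1" by (rule bchoice)
  then obtain P where P: "\<forall>u\<in>\<Union>pendents. fst (P u) \<in> pendents \<and> u \<in> fst (P u) \<and>
      set (snd (P u)) = fst (P u) - {u} \<and> length (snd (P u)) = r - 1" by (rule exE)
  define F where "F = (\<lambda>u. fst (P u))"
  define ws where "ws = (\<lambda>u. snd (P u))"
  have F: "F u \<in> pendents" "u \<in> F u" "set (ws u) = F u - {u}" "length (ws u) = r - 1"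
    if "u \<in> \<Union>pendents" for u
    using bspec[OF P that] unfolding F_def ws_def by blast+
  define g where "g = (\<lambda>z. case z of Center \<Rightarrow> v | Star_Vertex i j \<Rightarrow> us (es ! i) ! j
      | Pendent_Vertex i j p \<Rightarrow> ws (us (es ! i) ! j) ! p)"
  have place: "us (es ! i) ! j \<in> \<Union>pendents" "us (es ! i) ! j \<in> es ! i"
    if "(i, j) \<in> pendent_places ?as" for i j
  proof -
    have i: "i < ?t" and j: "j < load (es ! i)" using that by (auto simp: pendent_places_def)
    then have j': "j < r - 1" using load_le[OF esi[OF i]] by simp
    show "us (es ! i) ! j \<in> \<Union>pendents" using us3[OF esi[OF i] j'] j by simp
    have "us (es ! i) ! j \<in> set (us (es ! i))" using us(2)[OF esi[OF i]] j' by (intro nth_mem) simp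
    then show "us (es ! i) ! j \<in> es ! i" using us(1)[OF esi[OF i]] by simp
  qed
  have star: "g ` star_edge r i = es ! i" if i: "i < ?t" for i
  proof -
    have "g ` star_edge r i = insert v {us (es ! i) ! j | j. j < length (us (es ! i))}"
      unfolding us(2)[OF esi[OF i]] star_edge_def image_insert_Collect by (simp add: g_def)
    also have "\<dots> = insert v (es ! i - {v})"
      using us(1)[OF esi[OF i]] by (simp add: set_conv_nth)
    also have "\<dots> = es ! i" using esi[OF i] by (auto simp: spokes_def)
    finally show ?thesis .
  qed
  have attached: "g ` attached_edge r i j = F (us (es ! i) ! j)" if ij: "(i, j) \<in> pendent_places ?as" for i j
  proof -
    let ?u = "us (es ! i) ! j"
    have "g ` attached_edge r i j = insert ?u {ws ?u ! p | p. p < length (ws ?u)}"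
      unfolding F(4)[OF place(1)[OF ij]] attached_edge_def image_insert_Collect by (simp add: g_def)
    also have "\<dots> = insert ?u (F ?u - {?u})"
      using F(3)[OF place(1)[OF ij]] by (simp add: set_conv_nth)
    also have "\<dots> = F ?u" using F(2)[OF place(1)[OF ij]] by auto
    finally show ?thesis .
  qed
  have stars: "(\<lambda>i. g ` star_edge r i) ` {..<?t} = spokes"
  proof -
    have "(\<lambda>i. g ` star_edge r i) ` {..<?t} = (\<lambda>i. es ! i) ` {..<?t}"
      by (rule image_cong) (use star in auto)
    also have "\<dots> = set es" by (auto simp: set_conv_nth)
    finally show ?thesis using es by simp
  qed
  have "(\<lambda>(i, j). g ` attached_edge r i j) ` pendent_places ?as = pendents"
  proof (intro equalityI subsetI)
    fix f assume "f \<in> (\<lambda>(i, j). g ` attached_edge r i j) ` pendent_places ?as"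
    then obtain i j where ij: "(i, j) \<in> pendent_places ?as" "f = g ` attached_edge r i j" by auto
    then show "f \<in> pendents" using attached[OF ij(1)] F(1)[OF place(1)[OF ij(1)]] by simp
  next
    fix f assume f: "f \<in> pendents"
    obtain u where u: "f \<inter> hub = {u}" "u \<noteq> v" using pendents_hub[OF f] by blast
    then have "u \<in> f" "u \<in> hub" by auto
    then have "u \<in> \<Union>spokes" using u(2) by (simp add: hub_def)
    then obtain e where e: "e \<in> spokes" "u \<in> e" by blast
    have "e \<in> set es" using e es by simp
    then obtain i where i: "i < ?t" "es ! i = e" by (auto simp: in_set_conv_nth)
    have "u \<in> set (us e)" using us(1)[OF e(1)] e(2) u(2) by simp
    then obtain j where j: "j < r - 1" "us e ! j = u" using us(2)[OF e(1)] by (metis in_set_conv_nth)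
    have uP: "u \<in> \<Union>pendents" using f \<open>u \<in> f\<close> by blast
    then have "j < load e" using us3[OF e(1) j(1)] j(2) by simp
    then have ij: "(i, j) \<in> pendent_places ?as" using i by (simp add: pendent_places_def)
    have "F u = f" using pendents_unique[OF F(1)[OF uP] f F(2)[OF uP] \<open>u \<in> f\<close>] .
    then have "g ` attached_edge r i j = f" using attached[OF ij] i j by simp
    then show "f \<in> (\<lambda>(i, j). g ` attached_edge r i j) ` pendent_places ?as" using ij by force
  qed
  then have edg: "(\<lambda>e. g ` e) ` edges ?H = E"
    unfolding edges_S_hypertree image_Un image_image
    using stars E_split by (simp add: case_prod_unfold)
  have asle: "\<forall>a\<in>set ?as. a \<le> r - 1" using es load_le by auto
  note VH = verts_S_hypertree[OF asle]
  have finH: "finite (verts ?H)"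
    unfolding VH by (simp add: finite_pendent_places)
  have "card (verts ?H) \<le> Suc (?t * (r - 1) + card (pendent_places ?as) * (r - 1))"
  proof -
    have "card ((\<lambda>(i, j). Star_Vertex i j) ` ({..<length ?as} \<times> {..<r - 1})) \<le> ?t * (r - 1)"
      using card_image_le[of "{..<length ?as} \<times> {..<r - 1}" "\<lambda>(i, j). Star_Vertex i j"] by simp
    moreover have "card ((\<lambda>((i, j), p). Pendent_Vertex i j p) ` (pendent_places ?as \<times> {..<r - 1}))
        \<le> card (pendent_places ?as) * (r - 1)"
      using card_image_le[of "pendent_places ?as \<times> {..<r - 1}" "\<lambda>((i, j), p). Pendent_Vertex i j p"]
      by (simp add: finite_pendent_places)
    ultimately show ?thesis
      unfolding VH by (intro order.trans[OF card_insert_le_Suc] Suc_le_mono[THEN iffD2]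
          order.trans[OF card_Un_le] add_mono)
  qed
  also have "?t = card spokes" using distinct_card[OF es(1)] es(2) by simp
  also have "card (pendent_places ?as) = card pendents"
  proof -
    have "card (pendent_places ?as) = (\<Sum>i<?t. load (es ! i))"
      by (simp add: pendent_places_def card_SigmaI)
    also have "\<dots> = sum_list ?as" by (simp add: sum_list_sum_nth atLeast0LessThan)
    also have "\<dots> = (\<Sum>e\<in>spokes. load e)" using sum_list_distinct_conv_sum_set[OF es(1)] es(2) by simp
    finally show ?thesis using sum_load by simp
  qed
  also have "Suc (card spokes * (r - 1) + card pendents * (r - 1)) = card V"
    using count card_E by (simp add: algebra_simps)
  finally have cle: "card (verts ?H) \<le> card V" .
  have vH: "\<Union>(edges ?H) \<subseteq> verts ?H"
    by (auto simp: S_hypertree_def hyperstar_def Let_def)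
  have gV: "g ` verts ?H = V"
  proof (intro equalityI subsetI)
    fix w assume "w \<in> g ` verts ?H"
    then obtain z where z: "z \<in> verts ?H" "w = g z" by blast
    have "z = Center \<or> z \<in> \<Union>(edges ?H)"
      using z(1) by (auto simp: S_hypertree_def hyperstar_def Let_def)
    then show "w \<in> V"
    proof
      assume "z = Center"
      then show ?thesis using z(2) centre by (simp add: g_def)
    next
      assume "z \<in> \<Union>(edges ?H)"
      then obtain e where e: "e \<in> edges ?H" "z \<in> e" by blast
      then have "g ` e \<in> E" using edg by blast
      then show ?thesis using sub z(2) e(2) by blast
    qed
  next
    fix w assume w: "w \<in> V"
    show "w \<in> g ` verts ?H"
    proof (cases "w \<in> \<Union>E")
      case True
      then obtain e where "e \<in> E" "w \<in> e" by blast
      then obtain e' where "e' \<in> edges ?H" "w \<in> g ` e'" using edg by blast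
      then show ?thesis using vH by blast
    next
      case False
      then have "\<forall>e\<in>E. e \<subseteq> {w} \<or> e \<inter> {w} = {}" by blast
      then have "{w} = V" using con w unfolding cut_connected_def by blast
      then have "w = g Center" using centre by (auto simp: g_def)
      moreover have "Center \<in> verts ?H" unfolding VH by simp
      ultimately show ?thesis by blast
    qed
  qed
  have "card (g ` verts ?H) = card (verts ?H)"
    using card_image_le[OF finH, of g] cle gV by simp
  then have "inj_on g (verts ?H)" by (rule eq_card_imp_inj_on[OF finH])
  then have "bij_betw g (verts ?H) V" using gV by (simp add: bij_betw_def)
  then have "hypergraph_iso ?H (V, E)" using edg unfolding hypergraph_iso_def by auto
  then show ?thesis by (rule hypergraph_iso_sym) (use vH in blast)
qed

end

section \<open>A test vector on stars with pendent edges\<close>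

lemma powr_inverse_power: "0 < r \<Longrightarrow> 0 \<le> z \<Longrightarrow> (z powr (1 / real r)) ^ r = z"
  by (simp add: root_powr_inverse[symmetric])

lemma power_powr_inverse: "0 < r \<Longrightarrow> 0 \<le> z \<Longrightarrow> (z ^ r) powr (1 / real r) = z"
  by (simp add: root_powr_inverse[symmetric] real_root_power_cancel)

lemma sum_split_at:
  fixes u w :: real
  assumes "a \<le> n"
  shows "(\<Sum>j<n. if j < a then u else w) = real a * u + real (n - a) * w"
proof -
  have "{..<n} \<inter> {j. j < a} = {..<a}" "{..<n} \<inter> - {j. j < a} = {a..<n}" using assms by auto
  then show ?thesis by (simp add: sum.If_cases)
qed

lemma prod_split_at:
  fixes u :: real
  assumes "a \<le> n"
  shows "(\<Prod>j<n. if j < a then u else 1) = u ^ a"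
proof -
  have "{..<n} \<inter> {j. j < a} = {..<a}" using assms by auto
  then show ?thesis by (simp add: prod.If_cases)
qed

lemma inj_star_edge: "r \<ge> 2 \<Longrightarrow> inj_on (star_edge r) A"
proof (rule inj_onI)
  fix i k assume r: "r \<ge> 2" and eq: "star_edge r i = star_edge r k"
  have "Star_Vertex i 0 \<in> star_edge r i" using r by (simp add: star_edge_def)
  then have "Star_Vertex i 0 \<in> star_edge r k" using eq by simp
  then show "i = k" by (auto simp: star_edge_def)
qed

lemma inj_attached_edge: "inj_on (\<lambda>(i, j). attached_edge r i j) A"
proof (rule inj_onI, clarify)
  fix i j k l assume eq: "attached_edge r i j = attached_edge r k l"
  have "Star_Vertex i j \<in> attached_edge r i j" by (simp add: attached_edge_def)
  then have "Star_Vertex i j \<in> attached_edge r k l" using eq by simp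
  then show "i = k \<and> j = l" by (auto simp: attached_edge_def)
qed

text \<open>
  The vector for which the labelling bound is an equality on every edge: at each vertex \<open>w\<close> of an edge,
  label times \<open>x w ^ r\<close> must have the same value, and this determines \<open>x\<close> from its value \<open>1\<close> at the
  centre. Here \<open>y = 1 / (1 - \<alpha>)\<close>, and \<open>c i\<close> is the label of the centre in the \<open>i\<close>-th star edge.
\<close>
lemma S_hypertree_test_vector:
  fixes \<alpha> :: real
  assumes r: "r \<ge> 2" and as: "\<forall>a\<in>set as. a \<le> r - 1"
    and \<alpha>: "0 < \<alpha>" "\<alpha> \<le> 1" "\<alpha> < 1 \<or> (\<forall>a\<in>set as. a = 0)"
    and one: "(\<Sum>i<length as. \<alpha> * (1 / (1 - \<alpha>)) ^ (as ! i)) = 1"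
  obtains x where "\<And>z. 0 \<le> x z" "power_sum r (verts (S_hypertree r as)) x > 0"
    "\<alpha> powr (1 / r) * (real r * edge_sum (edges (S_hypertree r as)) x)
       = power_sum r (verts (S_hypertree r as)) x"
proof -
  let ?t = "length as" and ?H = "S_hypertree r as" and ?P = "pendent_places as"
  define y where "y = 1 / (1 - \<alpha>)"
  define c where "c = (\<lambda>i. \<alpha> * y ^ (as ! i))"
  have y0: "0 \<le> y" using \<alpha> by (simp add: y_def)
  have c0: "0 \<le> c i" for i using y0 \<alpha> by (simp add: c_def)
  have a_le: "as ! i \<le> r - 1" if "i < ?t" for i using as that by simp
  define x where "x = (\<lambda>z. case z of Center \<Rightarrow> 1
      | Star_Vertex i j \<Rightarrow> (c i * (if j < as ! i then y else 1)) powr (1 / r)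
      | Pendent_Vertex i j p \<Rightarrow> (\<alpha> * c i * y) powr (1 / r))"
  have x0: "0 \<le> x z" for z by (simp add: x_def split: S_vertex.split)
  have xC: "x Center = 1" and xS: "x (Star_Vertex i j) = (c i * (if j < as ! i then y else 1)) powr (1 / r)"
    and xP: "x (Pendent_Vertex i j p) = (\<alpha> * c i * y) powr (1 / r)" for i j p
    by (simp_all add: x_def)
  have r0: "0 < r" and rS: "Suc (r - 1) = r" using r by auto
  have star: "\<alpha> powr (1 / r) * (\<Prod>z\<in>star_edge r i. x z) = c i" if i: "i < ?t" for i
  proof -
    have se: "star_edge r i = insert Center (Star_Vertex i ` {..<r - 1})" by (auto simp: star_edge_def)
    have "(\<Prod>z\<in>star_edge r i. x z) = (\<Prod>j<r - 1. (c i * (if j < as ! i then y else 1)) powr (1 / r))"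
      unfolding se by (subst prod.insert) (auto simp: xC xS prod.reindex inj_on_def)
    also have "\<dots> = (\<Prod>j<r - 1. c i * (if j < as ! i then y else 1)) powr (1 / r)"
      by (rule prod_powr_distrib[symmetric])
    also have "(\<Prod>j<r - 1. c i * (if j < as ! i then y else 1)) = c i ^ (r - 1) * y ^ (as ! i)"
      unfolding prod.distrib prod_split_at[OF a_le[OF i]] by simp
    finally have "\<alpha> powr (1 / r) * (\<Prod>z\<in>star_edge r i. x z)
        = (\<alpha> * (c i ^ (r - 1) * y ^ (as ! i))) powr (1 / r)"
      using \<alpha> c0 y0 by (simp add: powr_mult)
    also have "\<alpha> * (c i ^ (r - 1) * y ^ (as ! i)) = c i ^ r"
    proof -
      have "\<alpha> * (c i ^ (r - 1) * y ^ (as ! i)) = c i * c i ^ (r - 1)" by (simp add: c_def)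
      then show ?thesis by (simp only: power_Suc[symmetric] rS)
    qed
    also have "(c i ^ r) powr (1 / r) = c i" by (rule power_powr_inverse[OF r0 c0])
    finally show ?thesis .
  qed
  have att: "\<alpha> powr (1 / r) * (\<Prod>z\<in>attached_edge r i j. x z) = \<alpha> * c i * y" if ij: "(i, j) \<in> ?P" for i j
  proof -
    have j: "j < as ! i" using ij by (simp add: pendent_places_def)
    have ae: "attached_edge r i j = insert (Star_Vertex i j) (Pendent_Vertex i j ` {..<r - 1})"
      by (auto simp: attached_edge_def)
    have "(\<Prod>z\<in>attached_edge r i j. x z) = (c i * y) powr (1 / r) * (\<Prod>p<r - 1. (\<alpha> * c i * y) powr (1 / r))"
      unfolding ae using j by (subst prod.insert) (auto simp: xP xS prod.reindex inj_on_def)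
    also have "(\<Prod>p<r - 1. (\<alpha> * c i * y) powr (1 / r)) = (\<Prod>p<r - 1. \<alpha> * c i * y) powr (1 / r)"
      by (rule prod_powr_distrib[symmetric])
    finally have "\<alpha> powr (1 / r) * (\<Prod>z\<in>attached_edge r i j. x z)
        = (\<alpha> * (c i * y * (\<alpha> * c i * y) ^ (r - 1))) powr (1 / r)"
      using \<alpha> c0 y0 by (simp add: powr_mult)
    also have "\<alpha> * (c i * y * (\<alpha> * c i * y) ^ (r - 1)) = (\<alpha> * c i * y) ^ r"
    proof -
      have "\<alpha> * (c i * y * (\<alpha> * c i * y) ^ (r - 1)) = (\<alpha> * c i * y) * (\<alpha> * c i * y) ^ (r - 1)"
        by (simp only: mult.assoc)
      then show ?thesis by (simp only: power_Suc[symmetric] rS)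
    qed
    also have "((\<alpha> * c i * y) ^ r) powr (1 / r) = \<alpha> * c i * y"
      by (rule power_powr_inverse[OF r0]) (use \<alpha> c0 y0 in simp)
    finally show ?thesis .
  qed
  have sumP: "(\<Sum>(i, j)\<in>?P. h i) = (\<Sum>i<?t. real (as ! i) * h i)" for h :: "nat \<Rightarrow> real"
    unfolding pendent_places_def by (subst sum.Sigma[symmetric]) auto
  have disj: "star_edge r ` {..<?t} \<inter> (\<lambda>(i, j). attached_edge r i j) ` ?P = {}"
    by (auto simp: star_edge_def attached_edge_def)
  have ES: "\<alpha> powr (1 / r) * edge_sum (edges ?H) x
      = (\<Sum>i<?t. c i) + (\<Sum>i<?t. real (as ! i) * (\<alpha> * c i * y))"
  proof -
    have "edge_sum (edges ?H) x = (\<Sum>e\<in>star_edge r ` {..<?t}. \<Prod>z\<in>e. x z)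
        + (\<Sum>e\<in>(\<lambda>(i, j). attached_edge r i j) ` ?P. \<Prod>z\<in>e. x z)"
      unfolding edge_sum_def edges_S_hypertree
      by (rule sum.union_disjoint[OF _ _ disj]) (simp_all add: finite_pendent_places)
    also have "(\<Sum>e\<in>star_edge r ` {..<?t}. \<Prod>z\<in>e. x z) = (\<Sum>i<?t. \<Prod>z\<in>star_edge r i. x z)"
      by (subst sum.reindex[OF inj_star_edge[OF r]]) simp
    also have "(\<Sum>e\<in>(\<lambda>(i, j). attached_edge r i j) ` ?P. \<Prod>z\<in>e. x z)
        = (\<Sum>(i, j)\<in>?P. \<Prod>z\<in>attached_edge r i j. x z)"
      by (subst sum.reindex[OF inj_attached_edge]) (simp add: case_prod_unfold o_def)
    finally have "\<alpha> powr (1 / r) * edge_sum (edges ?H) x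
        = (\<Sum>i<?t. \<alpha> powr (1 / r) * (\<Prod>z\<in>star_edge r i. x z))
          + (\<Sum>(i, j)\<in>?P. \<alpha> powr (1 / r) * (\<Prod>z\<in>attached_edge r i j. x z))"
      by (simp add: distrib_left sum_distrib_left case_prod_unfold)
    also have "(\<Sum>i<?t. \<alpha> powr (1 / r) * (\<Prod>z\<in>star_edge r i. x z)) = (\<Sum>i<?t. c i)"
      by (rule sum.cong) (use star in auto)
    also have "(\<Sum>(i, j)\<in>?P. \<alpha> powr (1 / r) * (\<Prod>z\<in>attached_edge r i j. x z)) = (\<Sum>(i, j)\<in>?P. \<alpha> * c i * y)"
      by (rule sum.cong) (use att in auto)
    finally show ?thesis unfolding sumP .
  qed
  let ?A = "(\<lambda>(i, j). Star_Vertex i j) ` ({..<?t} \<times> {..<r - 1})"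
  let ?B = "(\<lambda>((i, j), p). Pendent_Vertex i j p) ` (?P \<times> {..<r - 1})"
  have PS: "power_sum r (verts ?H) x
      = 1 + ((\<Sum>i<?t. c i * (as ! i * y + (r - 1 - as ! i))) + (\<Sum>i<?t. real (as ! i) * ((r - 1) * (\<alpha> * c i * y))))"
  proof -
    have fin: "finite ?A" "finite ?B" by (auto simp: finite_pendent_places)
    have "power_sum r (verts ?H) x = x Center ^ r + (\<Sum>z\<in>?A \<union> ?B. x z ^ r)"
      unfolding power_sum_def verts_S_hypertree[OF as]
      by (rule sum.insert) (use fin in auto)
    also have "(\<Sum>z\<in>?A \<union> ?B. x z ^ r) = (\<Sum>z\<in>?A. x z ^ r) + (\<Sum>z\<in>?B. x z ^ r)"
      by (rule sum.union_disjoint[OF fin]) auto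
    also have "(\<Sum>z\<in>?A. x z ^ r) = (\<Sum>(i, j)\<in>{..<?t} \<times> {..<r - 1}. c i * (if j < as ! i then y else 1))"
      using c0 y0 by (subst sum.reindex) (auto simp: inj_on_def xS powr_inverse_power[OF r0] case_prod_unfold intro!: sum.cong)
    also have "\<dots> = (\<Sum>i<?t. \<Sum>j<r - 1. c i * (if j < as ! i then y else 1))"
      by (rule sum.cartesian_product[symmetric])
    also have "\<dots> = (\<Sum>i<?t. c i * (as ! i * y + (r - 1 - as ! i)))"
      by (rule sum.cong) (simp_all add: sum_distrib_left[symmetric] sum_split_at a_le del: One_nat_def)
    also have "(\<Sum>z\<in>?B. x z ^ r) = (\<Sum>((i, j), p)\<in>?P \<times> {..<r - 1}. \<alpha> * c i * y)"
      using c0 y0 \<alpha> by (subst sum.reindex) (auto simp: inj_on_def xP powr_inverse_power[OF r0] case_prod_unfold intro!: sum.cong)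
    also have "\<dots> = (\<Sum>z\<in>?P. \<Sum>p<r - 1. \<alpha> * c (fst z) * y)"
      by (simp only: sum.cartesian_product case_prod_unfold)
    also have "\<dots> = (\<Sum>(i, j)\<in>?P. (r - 1) * (\<alpha> * c i * y))"
      by (simp add: case_prod_unfold)
    finally show ?thesis unfolding sumP xC by simp
  qed
  \<comment> \<open>the contribution of the \<open>i\<close>-th star edge; the \<open>1\<close> of the centre is distributed as \<open>\<Sum> c i\<close>\<close>
  have key: "c i + c i * (as ! i * y + (r - 1 - as ! i)) + as ! i * ((r - 1) * (\<alpha> * c i * y))
      = r * (c i + as ! i * (\<alpha> * c i * y))" if i: "i < ?t" for i
  proof -
    have "real (as ! i) * (y - 1) = as ! i * (\<alpha> * y)"
    proof (cases "as ! i = 0")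
      case False
      then have "\<alpha> < 1" using \<alpha>(3) nth_mem[OF i] by metis
      then have "y - 1 = \<alpha> * y" by (simp add: y_def field_simps)
      then show ?thesis by simp
    qed simp
    then have 1: "c i * (real (as ! i) * (y - 1)) = c i * (as ! i * (\<alpha> * y))" by simp
    have 2: "real (r - 1 - as ! i) = real r - 1 - as ! i" "real (r - 1) = real r - 1"
      using a_le[OF i] r by (simp_all add: of_nat_diff)
    show ?thesis using 1 unfolding 2 by algebra
  qed
  have c1: "(\<Sum>i<?t. c i) = 1" using one by (simp add: c_def y_def)
  have "power_sum r (verts ?H) x
      = (\<Sum>i<?t. c i + c i * (as ! i * y + (r - 1 - as ! i)) + as ! i * ((r - 1) * (\<alpha> * c i * y)))"
    unfolding PS sum.distrib c1 by simp
  also have "\<dots> = (\<Sum>i<?t. r * (c i + as ! i * (\<alpha> * c i * y)))"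
    by (rule sum.cong) (use key in auto)
  also have "\<dots> = real r * (\<alpha> powr (1 / r) * edge_sum (edges ?H) x)"
    unfolding ES by (simp only: sum_distrib_left[symmetric] sum.distrib)
  finally have eq: "\<alpha> powr (1 / r) * (real r * edge_sum (edges ?H) x) = power_sum r (verts ?H) x"
    by (simp only: mult.left_commute)
  have "power_sum r (verts ?H) x > 0"
    unfolding PS using c0 y0 \<alpha> by (intro add_pos_nonneg add_nonneg_nonneg sum_nonneg mult_nonneg_nonneg) auto
  with x0 eq show ?thesis using that by blast
qed

text \<open>
  A vector on \<open>verts H\<close> is pulled back along the isomorphism and tested in the variational principle.
\<close>
lemma (in uniform_system) iso_radius_ge:
  assumes iso: "hypergraph_iso (V, E) H"
    and x: "\<And>z. 0 \<le> x z" and pos: "power_sum r (verts H) x > 0"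
    and eq: "\<beta> * (real r * edge_sum (edges H) x) = power_sum r (verts H) x" and \<beta>: "\<beta> > 0"
  shows "\<beta> * spectral_radius r (V, E) \<ge> 1"
proof -
  obtain f where f: "bij_betw f V (verts H)" "(\<lambda>e. f ` e) ` E = edges H"
    using iso by (auto simp: hypergraph_iso_def)
  have inj: "inj_on f V" using f(1) by (simp add: bij_betw_def)
  have inj': "inj_on (\<lambda>e. f ` e) E"
    using inj_on_image_Pow[OF inj] by (rule inj_on_subset) (use sub in auto)
  have "edge_sum (edges H) x = (\<Sum>e\<in>E. \<Prod>z\<in>f ` e. x z)"
    unfolding edge_sum_def f(2)[symmetric] by (simp add: sum.reindex[OF inj'])
  also have "\<dots> = edge_sum E (\<lambda>v. x (f v))"
    unfolding edge_sum_def
  proof (rule sum.cong[OF refl])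
    fix e assume "e \<in> E"
    then have "inj_on f e" using inj_on_subset[OF inj sub] by blast
    then show "(\<Prod>z\<in>f ` e. x z) = (\<Prod>v\<in>e. x (f v))" by (simp add: prod.reindex)
  qed
  finally have 1: "edge_sum (edges H) x = edge_sum E (\<lambda>v. x (f v))" .
  have 2: "power_sum r (verts H) x = power_sum r V (\<lambda>v. x (f v))"
    unfolding power_sum_def by (rule sum.reindex_bij_betw[OF f(1), symmetric])
  have "real r * edge_sum (edges H) x \<le> spectral_radius r (V, E) * power_sum r (verts H) x"
    unfolding 1 2 by (rule rayleigh) (rule x)
  then have "\<beta> * (real r * edge_sum (edges H) x) \<le> \<beta> * (spectral_radius r (V, E) * power_sum r (verts H) x)"
    using \<beta> by simp
  then have "power_sum r (verts H) x \<le> \<beta> * spectral_radius r (V, E) * power_sum r (verts H) x"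
    using eq by (simp add: mult.assoc)
  then show ?thesis using pos by simp
qed

section \<open>The maximum root\<close>

lemma ivt_root:
  fixes h :: "real \<Rightarrow> real"
  assumes "continuous_on {0..1} h" "h 0 > 0" "h 1 < 0"
  obtains x where "0 < x" "x < 1" "h x = 0"
proof -
  obtain x where x: "0 \<le> x" "x \<le> 1" "h x = 0"
    using IVT2'[of h 1 0 0] assms by auto
  moreover have "x \<noteq> 0" "x \<noteq> 1" using x assms by auto
  ultimately show ?thesis using that[of x] by simp
qed

text \<open>
  The right-hand equation is that the labels at the centre of the extremal tree add up to \<open>1\<close>, with
  \<open>\<alpha> = 1 - x\<close>.
\<close>
lemma is_root_unit_interval:
  assumes x: "0 < x" "x < 1"
  shows "is_root r q s (int l) x \<longleftrightarrow> q * (1 / x) ^ (r - 1) + (1 / x) ^ s + l = 1 / (1 - x)"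
proof -
  have "x ^ (r - 1) > 0" using x by simp
  then show ?thesis using x
    by (auto simp: is_root_def power_one_over field_simps)
qed

text \<open>
  In the unit interval the left-hand side of \<open>is_root_unit_interval\<close> does not increase and the
  right-hand side increases strictly, so there is at most one root; beyond \<open>1\<close> the left-hand side of \<open>is_root\<close> is
  negative. The root is \<open>0\<close> only if the extremal tree is a single edge, and then the term with
  \<open>1 / x0 = 1 / 0\<close> occurs only with factor \<open>q = 0\<close> or exponent \<open>s = 0\<close>.
\<close>
lemma max_root_props:
  fixes r q s l :: nat
  assumes r: "r \<ge> 2" and s: "s < r - 1"
  defines "x0 \<equiv> max_root r q s (int l)"
  shows "0 \<le> x0" "x0 < 1" "(1 - x0) * (q * (1 / x0) ^ (r - 1) + (1 / x0) ^ s + l) = 1"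
    "x0 > 0 \<or> q = 0 \<and> s = 0"
proof -
  let ?R = "\<lambda>x. q * (1 / x) ^ (r - 1) + (1 / x) ^ s + real l"
  have "\<exists>x. 0 \<le> x \<and> x < 1 \<and> (1 - x) * ?R x = 1 \<and> (x > 0 \<or> q = 0 \<and> s = 0)"
  proof -
    consider "q > 0" | "q = 0" "s > 0" | "q = 0" "s = 0" by auto
    then show ?thesis
    proof cases
      case 1
      \<comment> \<open>the equation \<open>?R x = 1 / (1 - x)\<close> multiplied by \<open>(1 - x) * x ^ (r - 1)\<close>\<close>
      define h where "h = (\<lambda>x::real. (1 - x) * (q + x ^ (r - 1 - s) + l * x ^ (r - 1)) - x ^ (r - 1))"
      have "continuous_on {0..1} h" unfolding h_def by (intro continuous_intros)
      moreover have "h 0 > 0" "h 1 < 0" using 1 s by (auto simp: h_def power_0_left)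
      ultimately obtain x where x: "0 < x" "x < 1" "h x = 0" by (rule ivt_root)
      have "x ^ (r - 1) * ?R x = q + x ^ (r - 1 - s) + l * x ^ (r - 1)"
      proof -
        have "x ^ (r - 1) * (1 / x) ^ s = x ^ (r - 1 - s)"
          using x s by (simp add: power_diff power_one_over divide_inverse power_inverse)
        moreover have "x ^ (r - 1) * (1 / x) ^ (r - 1) = 1"
          using x by (simp flip: power_mult_distrib)
        ultimately show ?thesis by (simp add: algebra_simps)
      qed
      then have "x ^ (r - 1) * ((1 - x) * ?R x) = x ^ (r - 1) * 1"
        using x(3) unfolding h_def by (simp add: mult.left_commute)
      then have "(1 - x) * ?R x = 1" using x by simp
      then show ?thesis using x by (intro exI[of _ x]) simp
    next
      case 2
      \<comment> \<open>with \<open>q = 0\<close> the factor \<open>x ^ s\<close> suffices, and \<open>h 0\<close> becomes positive\<close>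
      define h where "h = (\<lambda>x::real. (1 - x) * (1 + l * x ^ s) - x ^ s)"
      have "continuous_on {0..1} h" unfolding h_def by (intro continuous_intros)
      moreover have "h 0 > 0" "h 1 < 0" using 2 by (auto simp: h_def power_0_left)
      ultimately obtain x where x: "0 < x" "x < 1" "h x = 0" by (rule ivt_root)
      have "x ^ s * ?R x = 1 + l * x ^ s"
        using x 2 by (simp add: algebra_simps flip: power_mult_distrib)
      then have "x ^ s * ((1 - x) * ?R x) = x ^ s * 1"
        using x(3) unfolding h_def by (simp add: mult.left_commute)
      then have "(1 - x) * ?R x = 1" using x by simp
      then show ?thesis using x by (intro exI[of _ x]) simp
    next
      case 3
      then show ?thesis by (intro exI[of _ "l / (l + 1)"]) (simp add: field_simps)
    qed
  qed
  then obtain x where x: "0 \<le> x" "x < 1" and eq: "(1 - x) * ?R x = 1" and deg: "x > 0 \<or> q = 0 \<and> s = 0"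
    by blast
  have R: "?R x = 1 / (1 - x)" using eq x by (simp add: field_simps)
  have root: "is_root r q s (int l) x"
  proof (cases "x = 0")
    case True
    then show ?thesis using deg r by (simp add: is_root_def power_0_left)
  next
    case False
    then show ?thesis using is_root_unit_interval[of x] x R by simp
  qed
  have max: "z \<le> x" if z: "is_root r q s (int l) z" for z
  proof (rule ccontr)
    assume "\<not> z \<le> x"
    then have xz: "x < z" by simp
    have "z \<noteq> 1" using z by (simp add: is_root_def)
    then consider "z < 1" | "z > 1" by linarith
    then show False
    proof cases
      case 1
      have "?R z \<le> ?R x"
      proof (cases "x = 0")
        case True
        then show ?thesis using deg by simp
      next
        case False
        then have "1 / z \<le> 1 / x" "0 \<le> 1 / z" using x xz by (simp_all add: frac_le)
        then show ?thesis by (intro add_mono mult_left_mono power_mono) auto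
      qed
      moreover have "?R z = 1 / (1 - z)" using is_root_unit_interval[of z] z 1 x xz by simp
      moreover have "1 / (1 - x) < 1 / (1 - z)" using xz 1 by (simp add: frac_less2)
      ultimately show False using R by simp
    next
      case 2
      have "1 / (1 - z) < 0" using 2 by simp
      moreover have "1 / z ^ s > 0" using 2 by simp
      moreover have "0 \<le> (of_int (int l) :: real)" by simp
      ultimately have "1 / (1 - z) - 1 / z ^ s - of_int (int l) < 0" by linarith
      then have "z ^ (r - 1) * (1 / (1 - z) - 1 / z ^ s - of_int (int l)) < 0"
        using 2 by (intro mult_pos_neg) auto
      then show False using z by (simp add: is_root_def)
    qed
  qed
  have "x0 = x" unfolding x0_def max_root_def by (intro Greatest_equality root max)
  then show "0 \<le> x0" "x0 < 1" "(1 - x0) * (q * (1 / x0) ^ (r - 1) + (1 / x0) ^ s + l) = 1"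
    "x0 > 0 \<or> q = 0 \<and> s = 0" using x eq deg by auto
qed

section \<open>The extremal hypertree\<close>

text \<open>
  The edge \<open>e0\<close> through \<open>v\<close> has load \<open>0\<close>, so the other \<open>m - k\<close> star edges carry \<open>k - 1\<close> pendent edges, at
  most \<open>r - 1\<close> each. This gives \<open>l \<ge> 0\<close>. The rest combines the labelling bound with convexity.
\<close>
lemma extremal_radius:
  fixes l :: int
  assumes r: "r \<ge> 2" and k: "k \<ge> 1" and kq: "k - 1 = (r - 1) * q + s" and s: "s < r - 1"
    and m: "int m = int q * int r + int s + 1 + l"
    and ext: "extremal r m k V E" and n: "card V = 1 + (r - 1) * m"
  defines "\<beta> \<equiv> (1 - max_root r q s l) powr (1 / real r)"
  shows "l \<ge> 0"
    and "\<beta> * spectral_radius r (V, E) \<le> 1"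
    and "\<beta> * spectral_radius r (V, E) = 1 \<Longrightarrow> hypergraph_iso (V, E) (A_hypertree r q s (nat l))"
proof -
  obtain v e0 where v: "v \<in> V" "pairwise disjnt {e \<in> E. v \<notin> e}" "card {e \<in> E. v \<notin> e} = k - 1"
    and e0: "e0 \<in> E" "v \<in> e0" "\<And>f. f \<in> E \<Longrightarrow> v \<notin> f \<Longrightarrow> disjnt e0 f"
    using extremal_structure[OF ext n k] by blast
  have adm: "admissible r m k V E" using ext by (simp add: extremal_def)
  then interpret uniform_system r V E by (simp add: admissible_def)
  have con: "cut_connected V E" and mE: "card E = m" using adm by (auto simp: admissible_def)
  interpret centred_tree r V E v
    by unfold_locales (use con n mE v in auto)
  have pk: "card pendents = k - 1" using v(3) by (simp add: pendents_def)
  have mk: "m = card spokes + (k - 1)" using card_E mE pk by simp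
  have e0s: "e0 \<in> spokes" using e0 by (simp add: spokes_def)
  have "load e0 = 0"
  proof -
    have "{f \<in> pendents. f \<inter> e0 \<noteq> {}} = {}" using e0(3) by (auto simp: pendents_def disjnt_def)
    then show ?thesis by (simp only: load_def card.empty)
  qed
  then have "k - 1 = (\<Sum>e\<in>spokes - {e0}. load e)"
    using sum_load pk sum.remove[OF fin_spokes e0s, of load] by simp
  also have "\<dots> \<le> (\<Sum>e\<in>spokes - {e0}. r - 1)" by (rule sum_mono) (use load_le in auto)
  also have "\<dots> = (r - 1) * (card spokes - 1)" using e0s fin_spokes by simp
  finally have "(r - 1) * q \<le> (r - 1) * (card spokes - 1)" using kq by linarith
  then have "q \<le> card spokes - 1" using r by simp
  moreover have "0 < card spokes" using e0s fin_spokes card_gt_0_iff by blast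
  ultimately have qs: "q + 1 \<le> card spokes" by simp
  have "int (card spokes) = int q + 1 + l"
  proof -
    have "int m = int (card spokes) + (int (r - 1) * int q + int s)"
      unfolding mk kq by simp
    moreover have "int (r - 1) = int r - 1" using r by simp
    ultimately show ?thesis using m by (simp add: algebra_simps)
  qed
  then show l: "l \<ge> 0" using qs by linarith
  define L where "L = nat l"
  have lL: "l = int L" using l by (simp add: L_def)
  have cs: "card spokes = q + 1 + L" using \<open>int (card spokes) = int q + 1 + l\<close> lL by linarith
  define x0 where "x0 = max_root r q s l"
  define \<alpha> where "\<alpha> = 1 - x0"
  have x0: "0 \<le> x0" "x0 < 1" "(1 - x0) * (q * (1 / x0) ^ (r - 1) + (1 / x0) ^ s + L) = 1"
    "x0 > 0 \<or> q = 0 \<and> s = 0"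
    using max_root_props[OF r s, of q L] unfolding x0_def lL by auto
  have \<alpha>: "0 < \<alpha>" "\<alpha> \<le> 1" and x0\<alpha>: "1 - \<alpha> = x0" using x0 by (auto simp: \<alpha>_def)
  have tot: "(\<Sum>e\<in>spokes. load e) = (r - 1) * q + s" using sum_load pk kq by simp
  have deg: "x0 > 0 \<or> k - 1 = 0" using x0(4) kq by auto
  have \<alpha>3: "\<alpha> < 1 \<or> pendents = {}"
    using deg pk fin_pendents by (auto simp: \<alpha>_def)
  have y: "1 / x0 > 1 \<or> (\<forall>e\<in>spokes. load e = 0)"
  proof (cases "x0 > 0")
    case True
    then show ?thesis using x0(2) by simp
  next
    case False
    then have "pendents = {}" using deg pk fin_pendents by simp
    then show ?thesis by (simp add: load_def)
  qed
  note opt = load_sum_extremal[OF fin_spokes load_le cs tot s y]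
  let ?Y = "\<Sum>e\<in>spokes. (1 / x0) ^ load e"
  have W: "(\<Sum>e\<in>spokes. \<alpha> * (1 / (1 - \<alpha>)) ^ load e) = \<alpha> * ?Y"
    unfolding x0\<alpha> by (simp add: sum_distrib_left)
  have bound1: "\<alpha> * (q * (1 / x0) ^ (r - 1) + (1 / x0) ^ s + L) = 1" using x0(3) by (simp add: \<alpha>_def)
  have W1: "\<alpha> * ?Y \<le> 1"
    using mult_left_mono[OF opt(1) less_imp_le[OF \<alpha>(1)]] bound1 by simp
  have \<beta>: "\<beta> = \<alpha> powr (1 / r)" by (simp add: \<beta>_def \<alpha>_def x0_def)
  show "\<beta> * spectral_radius r (V, E) \<le> 1"
    unfolding \<beta> by (rule radius_bound(1)[OF \<alpha> \<alpha>3]) (use W W1 in simp)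
  assume eq: "\<beta> * spectral_radius r (V, E) = 1"
  have "\<not> \<alpha> * ?Y < 1"
  proof
    assume "\<alpha> * ?Y < 1"
    then have "\<alpha> powr (1 / r) * spectral_radius r (V, E) < 1"
      by (intro radius_bound(2)[OF \<alpha> \<alpha>3]) (use W W1 in simp_all)
    then show False using eq \<beta> by simp
  qed
  then have "\<alpha> * ?Y = \<alpha> * (q * (1 / x0) ^ (r - 1) + (1 / x0) ^ s + L)" using W1 bound1 by simp
  then have "?Y = q * (1 / x0) ^ (r - 1) + (1 / x0) ^ s + L" using \<alpha>(1) by simp
  then obtain es where es: "distinct es" "set es = spokes"
    "map load es = replicate q (r - 1) @ [s] @ replicate L 0" using opt(2) by blast
  show "hypergraph_iso (V, E) (A_hypertree r q s (nat l))"
    using iso_S_hypertree[OF es(1,2)] unfolding es(3) A_hypertree_def L_def .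
qed

lemma sum_nth_eq_sum_list: "(\<Sum>i<length xs. f (xs ! i)) = (\<Sum>a\<leftarrow>xs. f a)"
  by (simp add: sum_list_sum_nth atLeast0LessThan)

lemma A_hypertree_radius_ge:
  fixes l :: nat
  assumes sys: "uniform_system r V E" and s: "s < r - 1"
    and iso: "hypergraph_iso (V, E) (A_hypertree r q s l)"
  shows "1 \<le> (1 - max_root r q s (int l)) powr (1 / real r) * spectral_radius r (V, E)"
proof -
  interpret uniform_system r V E by (rule sys)
  let ?as = "replicate q (r - 1) @ [s] @ replicate l 0"
  define x0 where "x0 = max_root r q s (int l)"
  have x0: "0 \<le> x0" "x0 < 1" "(1 - x0) * (q * (1 / x0) ^ (r - 1) + (1 / x0) ^ s + l) = 1"
    "x0 > 0 \<or> q = 0 \<and> s = 0"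
    using max_root_props[OF r2 s, of q l] unfolding x0_def by auto
  have \<alpha>: "0 < 1 - x0" "1 - x0 \<le> 1" using x0 by auto
  have as: "\<forall>a\<in>set ?as. a \<le> r - 1" using s by auto
  have deg: "1 - x0 < 1 \<or> (\<forall>a\<in>set ?as. a = 0)" using x0(4) by auto
  have "(\<Sum>i<length ?as. (1 - x0) * (1 / (1 - (1 - x0))) ^ (?as ! i))
      = (\<Sum>a\<leftarrow>?as. (1 - x0) * (1 / x0) ^ a)"
    unfolding diff_diff_eq2 add_diff_cancel_left' by (rule sum_nth_eq_sum_list)
  also have "\<dots> = (1 - x0) * (q * (1 / x0) ^ (r - 1) + (1 / x0) ^ s + l)"
    by (simp add: sum_list_replicate algebra_simps)
  also have "\<dots> = 1" by (rule x0(3))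
  finally have one: "(\<Sum>i<length ?as. (1 - x0) * (1 / (1 - (1 - x0))) ^ (?as ! i)) = 1" .
  obtain x where x: "\<And>z. 0 \<le> x z" "power_sum r (verts (S_hypertree r ?as)) x > 0"
    "(1 - x0) powr (1 / r) * (real r * edge_sum (edges (S_hypertree r ?as)) x)
       = power_sum r (verts (S_hypertree r ?as)) x"
    using S_hypertree_test_vector[OF r2 as \<alpha> deg one] by blast
  have "(1 - x0) powr (1 / r) > 0" using \<alpha> by simp
  then show ?thesis
    using iso_radius_ge[OF iso[unfolded A_hypertree_def] x] unfolding x0_def by simp
qed

lemma hypertree_admissible:
  assumes r: "r \<ge> 2" and m: "m \<ge> 1" and T: "(V, E) \<in> hypertrees_with_matching m k r"
  shows "admissible r m k V E" "card V = 1 + (r - 1) * m"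
proof -
  have H: "hypergraph (V, E)" "uniform r (V, E)" "hypertree (V, E)" "card E = m" "has_matching k (V, E)"
    using T by (auto simp: hypertrees_with_matching_def)
  have E: "e \<subseteq> V" "card e = r" if "e \<in> E" for e
    using H(1,2) that by (auto simp: hypergraph_def uniform_def)
  have "E \<noteq> {}" using H(4) m by auto
  then obtain e where "e \<in> E" by blast
  then have "V \<noteq> {}" using E r by fastforce
  then interpret uniform_system r V E
    using H(1) E r by unfold_locales (auto simp: hypergraph_def)
  have con: "cut_connected V E"
    using H(3) by (intro connected_imp_cut_connected) (simp add: hypertree_def)
  show "admissible r m k V E"
    using con H(4,5) uniform_system_axioms by (simp add: admissible_def)
  show "card V = 1 + (r - 1) * m"
    using hypertree_vertex_count[OF con] H(3,4) by (auto simp: hypertree_def)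
qed

text \<open>
  A hypertree is compared with an extremal one on the same vertex set. If it attains the bound, it is
  itself extremal, hence isomorphic to \<open>A_hypertree r q s (nat l)\<close>.
\<close>
theorem theorem4p1:
  fixes r m k q s :: nat and l :: int and T :: "'a hypergraph"
  assumes "r \<ge> 2" and "m \<ge> 1" and "k \<ge> 1"
    and "k - 1 = (r - 1) * q + s" and "s < r - 1"
    and "int m = int q * int r + int s + 1 + l"
    and "T \<in> hypertrees_with_matching m k r"
  shows "spectral_radius r T \<le> (1 / (1 - max_root r q s l)) powr (1 / real r) \<and>
         (spectral_radius r T = (1 / (1 - max_root r q s l)) powr (1 / real r) \<longleftrightarrow>
          hypergraph_iso T (A_hypertree r q s (nat l)))"
proof -
  obtain V E where TVE: "T = (V, E)" by (cases T)
  have adm: "admissible r m k V E" and n: "card V = 1 + (r - 1) * m"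
    using hypertree_admissible[of r m V E k] assms TVE by auto
  have sys: "uniform_system r V E" using adm by (simp add: admissible_def)
  define \<beta> where "\<beta> = (1 - max_root r q s l) powr (1 / real r)"
  obtain E' where ext: "extremal r m k V E'" using extremal_exists[OF adm] by blast
  note rad = extremal_radius[OF assms(1,3-6) _ n, folded \<beta>_def]
  have l: "l \<ge> 0" by (rule rad(1)[OF ext])
  have "max_root r q s l < 1" using max_root_props(2)[OF assms(1,5), of q "nat l"] l by simp
  then have \<beta>: "\<beta> > 0" and inv: "(1 / (1 - max_root r q s l)) powr (1 / real r) = 1 / \<beta>"
    by (simp_all add: \<beta>_def powr_divide)
  have le: "spectral_radius r (V, E) \<le> spectral_radius r (V, E')"
    using ext adm by (simp add: extremal_def)
  then have "\<beta> * spectral_radius r (V, E) \<le> \<beta> * spectral_radius r (V, E')" using \<beta> by simp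
  also have "\<dots> \<le> 1" by (rule rad(2)[OF ext])
  finally have le1: "\<beta> * spectral_radius r (V, E) \<le> 1" .
  have eq: "\<beta> * spectral_radius r (V, E) = 1 \<longleftrightarrow> hypergraph_iso (V, E) (A_hypertree r q s (nat l))"
  proof
    assume 1: "\<beta> * spectral_radius r (V, E) = 1"
    have "spectral_radius r (V, F) \<le> spectral_radius r (V, E)" if "admissible r m k V F" for F
    proof -
      have "spectral_radius r (V, F) \<le> spectral_radius r (V, E')"
        using ext that by (simp add: extremal_def)
      moreover have "\<beta> * spectral_radius r (V, E') \<le> \<beta> * spectral_radius r (V, E)"
        using rad(2)[OF ext] 1 by simp
      ultimately show ?thesis using \<beta> by simp
    qed
    then have "extremal r m k V E" using adm by (simp add: extremal_def)
    then show "hypergraph_iso (V, E) (A_hypertree r q s (nat l))" using 1 by (rule rad(3))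
  next
    assume "hypergraph_iso (V, E) (A_hypertree r q s (nat l))"
    then show "\<beta> * spectral_radius r (V, E) = 1"
      using A_hypertree_radius_ge[OF sys assms(5), of q "nat l"] le1 l by (simp add: \<beta>_def)
  qed
  show ?thesis
    unfolding TVE inv eq[symmetric] using le1 \<beta> by (simp add: field_simps)
qed

end
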